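(* Let $\mathcal M$ be a graded manifold and $\mathcal E$ a graded vector bundle over $\mathcal M$. For each $k\in\mathbb N_0$ and each open $U\subseteq M$, one has $\mathrm{Dif}^k_{\mathcal E}(U)\subseteq\mathrm{Loc}_{\mathcal E}(U)$. In fact, $\mathrm{Dif}^k_{\mathcal E}$ is a sheaf of graded $\mathcal C^\infty_{\mathcal M}$-submodules of the sheaf $\mathrm{Loc}_{\mathcal E}$.
   Context: Graded means $\mathbb{Z}$-graded. Graded vector spaces and modules are sequences indexed by $j\in\mathbb Z$; all elements are homogeneous and $|v|$ is the degree. A graded linear map $F$ of degree $|F|$ raises degree by $|F|$; it is linear over a graded commutative algebra if $F(f\cdot v)=(-1)^{|F||f|}f\cdot F(v)$. Graded manifold $\mathcal M$: a second countable Hausdorff space $M$ with a sheaf $\mathcal{C}^\infty_{\mathcal M}$ of graded commutative associative unital real algebras, locally isomorphic to the following model: an open subset of $\mathbb R^{n_0}$ with the sheaf of formal power series in graded commuting variables of nonzero degrees ($n_j$ of degree $j\neq 0$), with smooth coefficients; $\sum_j n_j$ is finite. Graded vector bundle $\mathcal E$: a sheaf $\Gamma_{\mathcal E}$ of graded $\mathcal{C}^\infty_{\mathcal M}$-modules locally isomorphic to $\mathcal{C}^\infty_{\mathcal M}\otimes_{\mathbb R}K$ for a fixed finite-dimensional graded vector space $K$. Local operators: a graded $\mathbb R$-linear map $F:\Gamma_{\mathcal E}(U)\to\Gamma_{\mathcal E}(U)$ of any degree is a local operator over $U$ if for any open $V\subseteq U$ and $\psi\in\Gamma_{\mathcal E}(U)$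 with $\psi|_V=0$, one has $F(\psi)|_V=0$. They form $\mathrm{Loc}_{\mathcal E}(U)$, with $(f\cdot F)(\psi)=f\cdot F(\psi)$. For $V\subseteq U$ open, $F|_V$ is the unique element of $\mathrm{Loc}_{\mathcal E}(V)$ with $F(\psi)|_V=F|_V(\psi|_V)$ for all $\psi\in\Gamma_{\mathcal E}(U)$; with these restrictions $\mathrm{Loc}_{\mathcal E}$ is a sheaf of graded $\mathcal C^\infty_{\mathcal M}$-modules. Differential operators: for $f\in\mathcal C^\infty_{\mathcal M}(U)$ let $\lambda_f(\psi)=f\cdot\psi$, and let $[A,B]=A\circ B-(-1)^{|A||B|}B\circ A$. A graded $\mathbb R$-linear map $D:\Gamma_{\mathcal E}(U)\to\Gamma_{\mathcal E}(U)$ (of any degree) is a $0$-th order differential operator over $U$ if it is $\mathcal C^\infty_{\mathcal M}(U)$-linear, and a $k$-th order one ($k\geq1$) if $[D,\lambda_f]$ is a $(k-1)$-th order one for every $f\in\mathcal C^\infty_{\mathcal M}(U)$. They form $\mathrm{Dif}^k_{\mathcal E}(U)$. *)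

theory Defs
  imports "HOL-Analysis.Analysis" "HOL-Algebra.Module"
begin

section \<open>Sheaves of graded vector spaces, graded algebras and graded modules\<close>

definition real_ring :: "real ring" where
  "real_ring = \<lparr>carrier = UNIV, mult = (*), one = 1, zero = 0, add = (+)\<rparr>"

definition rlinear :: "(real, 'a, 'm) module_scheme \<Rightarrow> (real, 'b, 'l) module_scheme \<Rightarrow> ('a \<Rightarrow> 'b) \<Rightarrow> bool"
  where "rlinear A B f \<longleftrightarrow>
    f \<in> carrier A \<rightarrow> carrier B \<and>
    (\<forall>x\<in>carrier A. \<forall>y\<in>carrier A. f (x \<oplus>\<^bsub>A\<^esub> y) = f x \<oplus>\<^bsub>B\<^esub> f y) \<and>
    (\<forall>c. \<forall>x\<in>carrier A. f (c \<odot>\<^bsub>A\<^esub> x) = c \<odot>\<^bsub>B\<^esub> f x)"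

text \<open>
  A graded object is a sequence of its homogeneous components, so every operation carries the
  degrees of its arguments: \<open>Sec S U j\<close> is the degree \<open>j\<close> component of the sections over \<open>U\<close>
  (a real vector space; the fields \<open>mult\<close> and \<open>one\<close> of the record are not used), and \<open>rst S U V j\<close>
  restricts sections of degree \<open>j\<close> from \<open>U\<close> to \<open>V\<close>. The product \<open>gmul C U i j f g\<close> is that of \<open>f\<close> of
  degree \<open>i\<close> with \<open>g\<close> of degree \<open>j\<close>, and similarly for the action \<open>act\<close> on a module. Only the values
  at open sets matter.
\<close>

record ('x, 's) gvs_sheaf =
  Sec :: "'x set \<Rightarrow> int \<Rightarrow> (real, 's) module"
  rst :: "'x set \<Rightarrow> 'x set \<Rightarrow> int \<Rightarrow> 's \<Rightarrow> 's"

record ('x, 'a) galg_sheaf = "('x, 'a) gvs_sheaf" +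
  gmul :: "'x set \<Rightarrow> int \<Rightarrow> int \<Rightarrow> 'a \<Rightarrow> 'a \<Rightarrow> 'a"
  gone :: "'x set \<Rightarrow> 'a"

record ('x, 'a, 's) gmod_sheaf = "('x, 's) gvs_sheaf" +
  act :: "'x set \<Rightarrow> int \<Rightarrow> int \<Rightarrow> 'a \<Rightarrow> 's \<Rightarrow> 's"

abbreviation secs :: "('x, 's, 'm) gvs_sheaf_scheme \<Rightarrow> 'x set \<Rightarrow> int \<Rightarrow> 's set" where
  "secs S U j \<equiv> carrier (Sec S U j)"

locale gvs_sheaf =
  fixes X :: "'x topology" and S :: "('x, 's, 'm) gvs_sheaf_scheme"
  assumes vs: "openin X U \<Longrightarrow> module real_ring (Sec S U j)"
    and rst_linear: "\<lbrakk>openin X U; openin X V; V \<subseteq> U\<rbrakk> \<Longrightarrow> rlinear (Sec S U j) (Sec S V j) (rst S U V j)"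
    and rst_id: "\<lbrakk>openin X U; s \<in> secs S U j\<rbrakk> \<Longrightarrow> rst S U U j s = s"
    and rst_rst: "\<lbrakk>openin X U; openin X V; openin X W; W \<subseteq> V; V \<subseteq> U; s \<in> secs S U j\<rbrakk>
      \<Longrightarrow> rst S V W j (rst S U V j s) = rst S U W j s"
    and separated: "\<lbrakk>\<forall>V\<in>\<V>. openin X V; s \<in> secs S (\<Union>\<V>) j; t \<in> secs S (\<Union>\<V>) j;
        \<forall>V\<in>\<V>. rst S (\<Union>\<V>) V j s = rst S (\<Union>\<V>) V j t\<rbrakk> \<Longrightarrow> s = t"
    and gluing: "\<lbrakk>\<forall>V\<in>\<V>. openin X V; \<forall>V\<in>\<V>. \<sigma> V \<in> secs S V j;
        \<forall>V\<in>\<V>. \<forall>W\<in>\<V>. rst S V (V \<inter> W) j (\<sigma> V) = rst S W (V \<inter> W) j (\<sigma> W)\<rbrakk>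
      \<Longrightarrow> \<exists>s\<in>secs S (\<Union>\<V>) j. \<forall>V\<in>\<V>. rst S (\<Union>\<V>) V j s = \<sigma> V"

locale galg_sheaf = gvs_sheaf X C
  for X :: "'x topology" and C :: "('x, 'a, 'm) galg_sheaf_scheme" +
  assumes gmul_linear_right: "\<lbrakk>openin X U; f \<in> secs C U i\<rbrakk>
      \<Longrightarrow> rlinear (Sec C U j) (Sec C U (i + j)) (gmul C U i j f)"
    and gmul_linear_left: "\<lbrakk>openin X U; g \<in> secs C U j\<rbrakk>
      \<Longrightarrow> rlinear (Sec C U i) (Sec C U (i + j)) (\<lambda>f. gmul C U i j f g)"
    and gmul_assoc: "\<lbrakk>openin X U; f \<in> secs C U i; g \<in> secs C U j; h \<in> secs C U l\<rbrakk>
      \<Longrightarrow> gmul C U (i + j) l (gmul C U i j f g) h = gmul C U i (j + l) f (gmul C U j l g h)"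
    and gmul_comm: "\<lbrakk>openin X U; f \<in> secs C U i; g \<in> secs C U j\<rbrakk>
      \<Longrightarrow> gmul C U i j f g = ((-1) powi (i * j)) \<odot>\<^bsub>Sec C U (i + j)\<^esub> gmul C U j i g f"
    and gone_closed: "openin X U \<Longrightarrow> gone C U \<in> secs C U 0"
    and gone_left: "\<lbrakk>openin X U; f \<in> secs C U i\<rbrakk> \<Longrightarrow> gmul C U 0 i (gone C U) f = f"
    and rst_gmul: "\<lbrakk>openin X U; openin X V; V \<subseteq> U; f \<in> secs C U i; g \<in> secs C U j\<rbrakk>
      \<Longrightarrow> rst C U V (i + j) (gmul C U i j f g) = gmul C V i j (rst C U V i f) (rst C U V j g)"
    and rst_gone: "\<lbrakk>openin X U; openin X V; V \<subseteq> U\<rbrakk> \<Longrightarrow> rst C U V 0 (gone C U) = gone C V"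

locale gmod_sheaf = alg: galg_sheaf X C + gvs_sheaf X S
  for X :: "'x topology" and C :: "('x, 'a, 'm) galg_sheaf_scheme"
    and S :: "('x, 'a, 's, 'l) gmod_sheaf_scheme" +
  assumes act_linear_right: "\<lbrakk>openin X U; f \<in> secs C U i\<rbrakk>
      \<Longrightarrow> rlinear (Sec S U j) (Sec S U (i + j)) (act S U i j f)"
    and act_linear_left: "\<lbrakk>openin X U; s \<in> secs S U j\<rbrakk>
      \<Longrightarrow> rlinear (Sec C U i) (Sec S U (i + j)) (\<lambda>f. act S U i j f s)"
    and act_assoc: "\<lbrakk>openin X U; f \<in> secs C U i; g \<in> secs C U j; s \<in> secs S U l\<rbrakk>
      \<Longrightarrow> act S U (i + j) l (gmul C U i j f g) s = act S U i (j + l) f (act S U j l g s)"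
    and act_gone: "\<lbrakk>openin X U; s \<in> secs S U j\<rbrakk> \<Longrightarrow> act S U 0 j (gone C U) s = s"
    and rst_act: "\<lbrakk>openin X U; openin X V; V \<subseteq> U; f \<in> secs C U i; s \<in> secs S U j\<rbrakk>
      \<Longrightarrow> rst S U V (i + j) (act S U i j f s) = act S V i j (rst C U V i f) (rst S U V j s)"

text \<open>\<open>T\<close> is a sheaf of graded submodules of the sheaf \<open>S\<close> of graded \<open>C\<close>-modules:\<close>

locale gmod_subsheaf = sup: gmod_sheaf X C S + sub: gmod_sheaf X C T
  for X :: "'x topology" and C :: "('x, 'a, 'm) galg_sheaf_scheme"
    and S :: "('x, 'a, 's, 'l) gmod_sheaf_scheme" and T :: "('x, 'a, 's, 'k) gmod_sheaf_scheme" +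
  assumes secs_subset: "openin X U \<Longrightarrow> secs T U j \<subseteq> secs S U j"
    and add_agrees: "\<lbrakk>openin X U; s \<in> secs T U j; t \<in> secs T U j\<rbrakk>
      \<Longrightarrow> s \<oplus>\<^bsub>Sec T U j\<^esub> t = s \<oplus>\<^bsub>Sec S U j\<^esub> t"
    and smult_agrees: "\<lbrakk>openin X U; s \<in> secs T U j\<rbrakk> \<Longrightarrow> c \<odot>\<^bsub>Sec T U j\<^esub> s = c \<odot>\<^bsub>Sec S U j\<^esub> s"
    and act_agrees: "\<lbrakk>openin X U; f \<in> secs C U i; s \<in> secs T U j\<rbrakk>
      \<Longrightarrow> act T U i j f s = act S U i j f s"
    and rst_agrees: "\<lbrakk>openin X U; openin X V; V \<subseteq> U; s \<in> secs T U j\<rbrakk>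
      \<Longrightarrow> rst T U V j s = rst S U V j s"


section \<open>The local model\<close>

text \<open>
  Smooth functions on an open subset \<open>U\<close> of \<open>Euclidean_space m\<close>, i.e. of \<open>\<real>\<^sup>m\<close> realised as the
  functions \<open>nat \<Rightarrow> real\<close> vanishing from index \<open>m\<close> on (so that \<open>m = 0\<close> is included). \<open>Ck_on m k U f\<close>:
  all iterated partial derivatives of \<open>f\<close> of order at most \<open>k\<close> exist and are continuous on \<open>U\<close>.
\<close>

primrec Ck_on :: "nat \<Rightarrow> nat \<Rightarrow> (nat \<Rightarrow> real) set \<Rightarrow> ((nat \<Rightarrow> real) \<Rightarrow> real) \<Rightarrow> bool" where
  "Ck_on m 0 U f \<longleftrightarrow> continuous_map (subtopology (Euclidean_space m) U) euclideanreal f"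
| "Ck_on m (Suc k) U f \<longleftrightarrow> continuous_map (subtopology (Euclidean_space m) U) euclideanreal f \<and>
     (\<forall>i<m. \<exists>g. (\<forall>x\<in>U. ((\<lambda>t. f (x(i := t))) has_real_derivative g x) (at (x i))) \<and> Ck_on m k U g)"

definition smooth_on :: "nat \<Rightarrow> (nat \<Rightarrow> real) set \<Rightarrow> ((nat \<Rightarrow> real) \<Rightarrow> real) \<Rightarrow> bool" where
  "smooth_on m U f \<longleftrightarrow> (\<forall>k. Ck_on m k U f)"

text \<open>
  For a graded dimension \<open>n\<close>, the base has dimension \<open>n 0\<close> and the formal variables are the pairs
  \<open>(j, i)\<close> with \<open>j \<noteq> 0\<close> and \<open>i < n j\<close>, the variable \<open>(j, i)\<close> having degree \<open>j\<close>. A monomial is given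
  by its exponents; \<open>midx n d\<close> indexes the monomials of degree \<open>d\<close>. Odd variables square to zero.
\<close>

definition gvars :: "(int \<Rightarrow> nat) \<Rightarrow> (int \<times> nat) set" where
  "gvars n = {(j, i). j \<noteq> 0 \<and> i < n j}"

definition midx :: "(int \<Rightarrow> nat) \<Rightarrow> int \<Rightarrow> (int \<times> nat \<Rightarrow> nat) set" where
  "midx n d = {p. (\<forall>v. v \<notin> gvars n \<longrightarrow> p v = 0) \<and> (\<forall>v. odd (fst v) \<longrightarrow> p v \<le> 1) \<and>
     (\<Sum>v\<in>gvars n. int (p v) * fst v) = d}"

text \<open>
  The monomial with exponents \<open>p\<close> is the product of the powers of the variables in increasing
  lexicographic order. Sorting the product of the monomials with exponents \<open>q\<close> and \<open>r\<close> moves each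
  variable \<open>w\<close> of the second past all the variables \<open>v > w\<close> of the first, which gives the sign below.
\<close>

definition msign :: "(int \<Rightarrow> nat) \<Rightarrow> (int \<times> nat \<Rightarrow> nat) \<Rightarrow> (int \<times> nat \<Rightarrow> nat) \<Rightarrow> real" where
  "msign n q r = (-1) powi
     (\<Sum>(v, w) \<in> {(v, w) \<in> gvars n \<times> gvars n. fst w < fst v \<or> fst w = fst v \<and> snd w < snd v}.
        int (q v) * int (r w) * (fst v * fst w))"

text \<open>A section of degree \<open>d\<close> is the family of the coefficients of the monomials of degree \<open>d\<close>.\<close>

definition model :: "(int \<Rightarrow> nat) \<Rightarrow> (nat \<Rightarrow> real, (int \<times> nat \<Rightarrow> nat) \<Rightarrow> (nat \<Rightarrow> real) \<Rightarrow> real) galg_sheaf"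
  where "model n =
    \<lparr>Sec = (\<lambda>U d.
       \<lparr>carrier = midx n d \<rightarrow>\<^sub>E {g \<in> extensional U. smooth_on (n 0) U g},
        mult = undefined, one = undefined,
        zero = (\<lambda>p\<in>midx n d. \<lambda>x\<in>U. 0),
        add = (\<lambda>f g. \<lambda>p\<in>midx n d. \<lambda>x\<in>U. f p x + g p x),
        smult = (\<lambda>c f. \<lambda>p\<in>midx n d. \<lambda>x\<in>U. c * f p x)\<rparr>),
     rst = (\<lambda>U V d f. \<lambda>p\<in>midx n d. restrict (f p) V),
     gmul = (\<lambda>U i j f g. \<lambda>p\<in>midx n (i + j). \<lambda>x\<in>U.
       \<Sum>(q, r) \<in> {(q, r) \<in> midx n i \<times> midx n j. \<forall>v. q v + r v = p v}. msign n q r * f q x * g r x),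
     gone = (\<lambda>U. \<lambda>p\<in>midx n 0. \<lambda>x\<in>U. if p = (\<lambda>v. 0) then 1 else 0)\<rparr>"


section \<open>Graded manifolds and graded vector bundles\<close>

text \<open>
  \<open>h\<close> is a homeomorphism from the open set \<open>V\<close> onto the open set \<open>\<Omega>\<close> of \<open>\<real>\<^bsup>n 0\<^esup>\<close>, and \<open>\<phi>\<close> an isomorphism
  over \<open>h\<close> from \<open>C\<close> restricted to \<open>V\<close> to the model over \<open>\<Omega>\<close>.
\<close>

definition graded_chart ::
  "'x topology \<Rightarrow> (int \<Rightarrow> nat) \<Rightarrow> ('x, 'a, 'm) galg_sheaf_scheme \<Rightarrow> 'x set \<Rightarrow> (nat \<Rightarrow> real) set \<Rightarrow>
   ('x \<Rightarrow> nat \<Rightarrow> real) \<Rightarrow>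
   ('x set \<Rightarrow> int \<Rightarrow> 'a \<Rightarrow> (int \<times> nat \<Rightarrow> nat) \<Rightarrow> (nat \<Rightarrow> real) \<Rightarrow> real) \<Rightarrow> bool"
  where "graded_chart X n C V \<Omega> h \<phi> \<longleftrightarrow>
    openin X V \<and> openin (Euclidean_space (n 0)) \<Omega> \<and>
    homeomorphic_map (subtopology X V) (subtopology (Euclidean_space (n 0)) \<Omega>) h \<and>
    (\<forall>W. openin X W \<and> W \<subseteq> V \<longrightarrow>
      (\<forall>d. bij_betw (\<phi> W d) (secs C W d) (secs (model n) (h ` W) d) \<and>
           rlinear (Sec C W d) (Sec (model n) (h ` W) d) (\<phi> W d)) \<and>
      (\<forall>i j. \<forall>f\<in>secs C W i. \<forall>g\<in>secs C W j.
         \<phi> W (i + j) (gmul C W i j f g) = gmul (model n) (h ` W) i j (\<phi> W i f) (\<phi> W j g)) \<and>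
      \<phi> W 0 (gone C W) = gone (model n) (h ` W) \<and>
      (\<forall>W'. openin X W' \<and> W' \<subseteq> W \<longrightarrow> (\<forall>d. \<forall>f\<in>secs C W d.
         \<phi> W' d (rst C W W' d f) = rst (model n) (h ` W) (h ` W') d (\<phi> W d f))))"

locale graded_manifold = galg_sheaf X C
  for X :: "'x topology" and n :: "int \<Rightarrow> nat" and C :: "('x, 'a, 'm) galg_sheaf_scheme" +
  assumes hausdorff: "Hausdorff_space X"
    and second_countable: "second_countable X"
    and finite_dim: "finite {j. n j \<noteq> 0}"
    and charts: "x \<in> topspace X \<Longrightarrow> \<exists>V \<Omega> h \<phi>. x \<in> V \<and> graded_chart X n C V \<Omega> h \<phi>"

text \<open>
  The sheaf \<open>C \<otimes> K\<close>, where \<open>K\<close> is the graded vector space with components \<open>\<real>\<^bsup>r j\<^esup>\<close>. Its section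
  \<open>s\<close> of degree \<open>d\<close> stands for the sum of the \<open>s (j, i) \<otimes> e (j, i)\<close>, where \<open>e (j, i)\<close> for \<open>i < r j\<close>
  is the standard basis of \<open>\<real>\<^bsup>r j\<^esup>\<close>, and \<open>s (j, i)\<close> has degree \<open>d - j\<close>.
\<close>

definition gbasis :: "(int \<Rightarrow> nat) \<Rightarrow> (int \<times> nat) set" where
  "gbasis r = {(j, i). i < r j}"

definition tensor_sheaf ::
  "('x, 'a, 'm) galg_sheaf_scheme \<Rightarrow> (int \<Rightarrow> nat) \<Rightarrow> ('x, 'a, int \<times> nat \<Rightarrow> 'a) gmod_sheaf"
  where "tensor_sheaf C r =
    \<lparr>Sec = (\<lambda>U d.
       \<lparr>carrier = (\<Pi>\<^sub>E v\<in>gbasis r. secs C U (d - fst v)),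
        mult = undefined, one = undefined,
        zero = (\<lambda>v\<in>gbasis r. \<zero>\<^bsub>Sec C U (d - fst v)\<^esub>),
        add = (\<lambda>s t. \<lambda>v\<in>gbasis r. s v \<oplus>\<^bsub>Sec C U (d - fst v)\<^esub> t v),
        smult = (\<lambda>c s. \<lambda>v\<in>gbasis r. c \<odot>\<^bsub>Sec C U (d - fst v)\<^esub> s v)\<rparr>),
     rst = (\<lambda>U V d s. \<lambda>v\<in>gbasis r. rst C U V (d - fst v) (s v)),
     act = (\<lambda>U i d f s. \<lambda>v\<in>gbasis r. gmul C U i (d - fst v) f (s v))\<rparr>"

definition gmod_iso_on ::
  "'x topology \<Rightarrow> ('x, 'a, 'm) galg_sheaf_scheme \<Rightarrow> 'x set \<Rightarrow> ('x, 'a, 's, 'l) gmod_sheaf_scheme \<Rightarrow>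
   ('x, 'a, 't, 'k) gmod_sheaf_scheme \<Rightarrow> ('x set \<Rightarrow> int \<Rightarrow> 's \<Rightarrow> 't) \<Rightarrow> bool"
  where "gmod_iso_on X C V S T \<phi> \<longleftrightarrow>
    (\<forall>W. openin X W \<and> W \<subseteq> V \<longrightarrow>
      (\<forall>d. bij_betw (\<phi> W d) (secs S W d) (secs T W d) \<and> rlinear (Sec S W d) (Sec T W d) (\<phi> W d)) \<and>
      (\<forall>i d. \<forall>f\<in>secs C W i. \<forall>s\<in>secs S W d.
         \<phi> W (i + d) (act S W i d f s) = act T W i d f (\<phi> W d s)) \<and>
      (\<forall>W'. openin X W' \<and> W' \<subseteq> W \<longrightarrow> (\<forall>d. \<forall>s\<in>secs S W d.
         \<phi> W' d (rst S W W' d s) = rst T W W' d (\<phi> W d s))))"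

locale graded_vector_bundle = graded_manifold X n C + gmod_sheaf X C E
  for X :: "'x topology" and n :: "int \<Rightarrow> nat" and C :: "('x, 'a, 'm) galg_sheaf_scheme"
    and r :: "int \<Rightarrow> nat" and E :: "('x, 'a, 's, 'l) gmod_sheaf_scheme" +
  assumes finite_rank: "finite {j. r j \<noteq> 0}"
    and trivializations: "x \<in> topspace X \<Longrightarrow>
      \<exists>V \<phi>. openin X V \<and> x \<in> V \<and> gmod_iso_on X C V E (tensor_sheaf C r) \<phi>"


section \<open>Local operators and differential operators\<close>

text \<open>
  A graded linear map \<open>F\<close> of degree \<open>d\<close> is the family of its components \<open>F j\<close> from degree \<open>j\<close> to
  degree \<open>j + d\<close>, each of them extensional, so that equality of maps is equality in HOL.
\<close>

definition graded_maps :: "('x, 's, 'm) gvs_sheaf_scheme \<Rightarrow> 'x set \<Rightarrow> int \<Rightarrow> (int \<Rightarrow> 's \<Rightarrow> 's) set" where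
  "graded_maps E U d =
    {F. \<forall>j. F j \<in> extensional (secs E U j) \<and> rlinear (Sec E U j) (Sec E U (j + d)) (F j)}"

definition Loc :: "'x topology \<Rightarrow> ('x, 's, 'm) gvs_sheaf_scheme \<Rightarrow> 'x set \<Rightarrow> int \<Rightarrow> (int \<Rightarrow> 's \<Rightarrow> 's) set"
  where "Loc X E U d =
    {F \<in> graded_maps E U d. \<forall>V. openin X V \<and> V \<subseteq> U \<longrightarrow> (\<forall>j. \<forall>\<psi>\<in>secs E U j.
       rst E U V j \<psi> = \<zero>\<^bsub>Sec E V j\<^esub> \<longrightarrow> rst E U V (j + d) (F j \<psi>) = \<zero>\<^bsub>Sec E V (j + d)\<^esub>)}"

definition mul_op :: "('x, 'a, 's, 'm) gmod_sheaf_scheme \<Rightarrow> 'x set \<Rightarrow> int \<Rightarrow> 'a \<Rightarrow> int \<Rightarrow> 's \<Rightarrow> 's" where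
  "mul_op E U i f = (\<lambda>j. \<lambda>\<psi>\<in>secs E U j. act E U i j f \<psi>)"

text \<open>\<open>gcomm E U a A b B\<close> is the graded commutator of \<open>A\<close> of degree \<open>a\<close> and \<open>B\<close> of degree \<open>b\<close>.\<close>

definition gcomm :: "('x, 's, 'm) gvs_sheaf_scheme \<Rightarrow> 'x set \<Rightarrow>
    int \<Rightarrow> (int \<Rightarrow> 's \<Rightarrow> 's) \<Rightarrow> int \<Rightarrow> (int \<Rightarrow> 's \<Rightarrow> 's) \<Rightarrow> int \<Rightarrow> 's \<Rightarrow> 's" where
  "gcomm E U a A b B = (\<lambda>j. \<lambda>\<psi>\<in>secs E U j.
     A (j + b) (B j \<psi>) \<ominus>\<^bsub>Sec E U (j + a + b)\<^esub>
       (((-1) powi (a * b)) \<odot>\<^bsub>Sec E U (j + a + b)\<^esub> B (j + a) (A j \<psi>)))"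

primrec Dif :: "('x, 'a, 'm) galg_sheaf_scheme \<Rightarrow> ('x, 'a, 's, 'l) gmod_sheaf_scheme \<Rightarrow> nat \<Rightarrow>
    'x set \<Rightarrow> int \<Rightarrow> (int \<Rightarrow> 's \<Rightarrow> 's) set" where
  "Dif C E 0 = (\<lambda>U d. {D \<in> graded_maps E U d. \<forall>i j. \<forall>f\<in>secs C U i. \<forall>\<psi>\<in>secs E U j.
     D (i + j) (act E U i j f \<psi>) =
       ((-1) powi (d * i)) \<odot>\<^bsub>Sec E U (i + j + d)\<^esub> act E U i (j + d) f (D j \<psi>)})"
| "Dif C E (Suc k) = (\<lambda>U d. {D \<in> graded_maps E U d. \<forall>i. \<forall>f\<in>secs C U i.
     gcomm E U d D i (mul_op E U i f) \<in> Dif C E k U (d + i)})"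

text \<open>
  The graded module sheaf structure (pointwise linear structure, pointwise action, restriction
  of local operators) on a family \<open>H U d\<close> of sets of local operators over \<open>U\<close> of degree \<open>d\<close>.
\<close>

definition op_sheaf :: "'x topology \<Rightarrow> ('x, 'a, 's, 'm) gmod_sheaf_scheme \<Rightarrow>
    ('x set \<Rightarrow> int \<Rightarrow> (int \<Rightarrow> 's \<Rightarrow> 's) set) \<Rightarrow> ('x, 'a, int \<Rightarrow> 's \<Rightarrow> 's) gmod_sheaf"
  where "op_sheaf X E H =
    \<lparr>Sec = (\<lambda>U d.
       \<lparr>carrier = H U d,
        mult = undefined, one = undefined,
        zero = (\<lambda>j. \<lambda>\<psi>\<in>secs E U j. \<zero>\<^bsub>Sec E U (j + d)\<^esub>),
        add = (\<lambda>F G j. \<lambda>\<psi>\<in>secs E U j. F j \<psi> \<oplus>\<^bsub>Sec E U (j + d)\<^esub> G j \<psi>),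
        smult = (\<lambda>c F j. \<lambda>\<psi>\<in>secs E U j. c \<odot>\<^bsub>Sec E U (j + d)\<^esub> F j \<psi>)\<rparr>),
     rst = (\<lambda>U V d F. THE G. G \<in> Loc X E V d \<and>
       (\<forall>j. \<forall>\<psi>\<in>secs E U j. rst E U V (j + d) (F j \<psi>) = G j (rst E U V j \<psi>))),
     act = (\<lambda>U i d f F j. \<lambda>\<psi>\<in>secs E U j. act E U i (j + d) f (F j \<psi>))\<rparr>"

definition Loc_sheaf :: "'x topology \<Rightarrow> ('x, 'a, 's, 'm) gmod_sheaf_scheme \<Rightarrow>
    ('x, 'a, int \<Rightarrow> 's \<Rightarrow> 's) gmod_sheaf" where
  "Loc_sheaf X E = op_sheaf X E (Loc X E)"

definition Dif_sheaf :: "'x topology \<Rightarrow> ('x, 'a, 'm) galg_sheaf_scheme \<Rightarrow>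
    ('x, 'a, 's, 'l) gmod_sheaf_scheme \<Rightarrow> nat \<Rightarrow> ('x, 'a, int \<Rightarrow> 's \<Rightarrow> 's) gmod_sheaf" where
  "Dif_sheaf X C E k = op_sheaf X E (Dif C E k)"

end

theory Submission
  imports Defs "HOL-Computational_Algebra.Polynomial"
begin

text \<open>
  Multiplication operators do not enlarge supports, and a differential operator \<open>D\<close> of order \<open>k\<close> is
  local because its commutators with them are differential operators of lower order. If \<open>\<psi>\<close> vanishes
  on \<open>V\<close> and \<open>l\<close> is a function of degree 0 that is 1 near a given point of \<open>V\<close> and 0 outside a closed
  subset of \<open>V\<close>, then \<open>l \<psi> = 0\<close>, hence \<open>l D(\<psi>) = - [D, l](\<psi>)\<close>. If \<open>[D, l]\<close> is local, the right-hand
  side vanishes on \<open>V\<close>, and so \<open>D(\<psi>)\<close> vanishes near the point (\<open>local_if_commutators_local\<close>).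

  The cutoff functions \<open>l\<close> are the only thing that is needed of the graded manifold. In a chart, \<open>l\<close> is
  the body of a smooth bump function, all other coefficients being zero; it is extended by zero, which
  is possible because compact subsets of a Hausdorff space are closed (\<open>exists_cutoff\<close>). Everything after
  that holds over any sheaf of graded algebras with cutoffs, for an arbitrary sheaf of graded modules
  (\<open>gmod_sheaf_with_cutoffs\<close>). Cutoffs show that each section over \<open>V \<subseteq> U\<close> agrees near each point of \<open>V\<close>
  with a section over \<open>U\<close>. Hence a local operator over \<open>U\<close> restricts to \<open>V\<close> in exactly one way, and
  local operators satisfy the sheaf axioms.

  For the differential operators, call a family \<open>H\<close> of sets of local operators a subsheaf if it is
  closed under the module operations and restriction, and if membership is a local condition
  (\<open>local_operator_subsheaf\<close>). If \<open>K\<close> is a subsheaf, then so is the family of the local operators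
  all of whose commutators with functions lie in \<open>K\<close> (\<open>commutator_subsheaf\<close>). This follows from
  \<open>[g D, f] = g [D, f]\<close>, and from the fact that commutators are compatible with restriction; a function on
  \<open>V\<close> need not extend to \<open>U\<close>, but it does so near each point, and membership in \<open>K\<close> is local. The differential
  operators of order 0 arise in this way from the zero operators, and those of order \<open>k + 1\<close>
  from those of order \<open>k\<close>. The locality criterion above makes the condition that the operator be local
  redundant, so \<open>Dif C E k\<close> is a subsheaf for every \<open>k\<close> by induction.
\<close>


section \<open>Smooth bump functions on Euclidean space\<close>

text \<open>
  The functions \<open>t \<mapsto> P(1/t) exp(-1/t)\<close> for \<open>t > 0\<close>, extended by 0. The polynomial \<open>P\<close> is a parameter in order
  that this family be closed under differentiation.
\<close>

definition flat :: "real poly \<Rightarrow> real \<Rightarrow> real" where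
  "flat P t = (if 0 < t then poly P (1 / t) * exp (- (1 / t)) else 0)"

text \<open>The polynomial of the derivative of \<open>flat P\<close>:\<close>

definition flat_deriv :: "real poly \<Rightarrow> real poly" where
  "flat_deriv P = [:0, 0, 1:] * (P - pderiv P)"

lemma tendsto_poly_times_exp_neg:
  fixes P :: "real poly"
  shows "((\<lambda>y. poly P y * exp (- y)) \<longlongrightarrow> 0) at_top"
proof -
  have "((\<lambda>y. \<Sum>i\<le>degree P. coeff P i * (y ^ i / exp y)) \<longlongrightarrow> (\<Sum>i\<le>degree P. coeff P i * 0)) at_top"
    by (intro tendsto_sum tendsto_mult tendsto_const tendsto_power_div_exp_0)
  then show ?thesis
    by (simp add: poly_altdef sum_distrib_right exp_minus divide_inverse mult.assoc)
qed

lemma tendsto_flat_at_right_0: "(flat P \<longlongrightarrow> 0) (at_right 0)"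
proof -
  have "((\<lambda>t. poly P (inverse t) * exp (- inverse t)) \<longlongrightarrow> 0) (at_right 0)"
    by (rule filterlim_compose[OF tendsto_poly_times_exp_neg filterlim_inverse_at_top_right])
  then show ?thesis
    by (rule Lim_transform_eventually)
      (auto simp: flat_def eventually_at_filter divide_inverse)
qed

lemma flat_has_derivative: "(flat P has_real_derivative flat (flat_deriv P) t) (at t)"
proof -
  consider "t > 0" | "t < 0" | "t = 0" by linarith
  then show ?thesis
  proof cases
    case 1
    have "((\<lambda>t. poly P (1 / t) * exp (- (1 / t))) has_real_derivative flat (flat_deriv P) t) (at t)"
      using 1 by (auto intro!: derivative_eq_intros DERIV_chain'[OF _ poly_DERIV]
          simp: flat_def flat_deriv_def field_simps power2_eq_square)
    moreover have "eventually (\<lambda>s. flat P s = poly P (1 / s) * exp (- (1 / s))) (nhds t)"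
      using eventually_nhds_in_open[of "{0<..}" t] 1 by (auto simp: flat_def elim!: eventually_mono)
    ultimately show ?thesis by (subst DERIV_cong_ev[OF refl _ refl])
  next
    case 2
    have "eventually (\<lambda>s. flat P s = 0) (nhds t)"
      using eventually_nhds_in_open[of "{..<0}" t] 2 by (auto simp: flat_def elim!: eventually_mono)
    then show ?thesis using 2 by (subst DERIV_cong_ev[OF refl _ refl]) (auto simp: flat_def)
  next
    case 3
    \<comment> \<open>For \<open>h > 0\<close> the difference quotient at 0 is \<open>flat ([:0, 1:] * P) h\<close>.\<close>
    have "((\<lambda>h. flat P h / h) \<longlongrightarrow> 0) (at_right 0)"
      by (rule Lim_transform_eventually[OF tendsto_flat_at_right_0[of "[:0, 1:] * P"]])
        (auto simp: flat_def eventually_at_filter)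
    moreover have "((\<lambda>h. flat P h / h) \<longlongrightarrow> 0) (at_left 0)"
      by (rule Lim_transform_eventually[OF tendsto_const])
        (auto simp: flat_def eventually_at_filter)
    ultimately have "((\<lambda>h. flat P h / h) \<longlongrightarrow> 0) (at 0)"
      by (simp add: filterlim_split_at)
    then show ?thesis using 3 by (simp add: DERIV_def flat_def)
  qed
qed

text \<open>
  The functions of the first \<open>m\<close> coordinates built from constants, coordinates, sums, products
  and composition with functions \<open>flat P\<close>. They are continuous and closed under partial derivatives, hence
  smooth; no multivariate calculus is needed.
\<close>

inductive smooth_expr :: "nat \<Rightarrow> ((nat \<Rightarrow> real) \<Rightarrow> real) \<Rightarrow> bool" for m where
  const: "smooth_expr m (\<lambda>x. c)"
| coord: "i < m \<Longrightarrow> smooth_expr m (\<lambda>x. x i)"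
| add: "smooth_expr m F \<Longrightarrow> smooth_expr m G \<Longrightarrow> smooth_expr m (\<lambda>x. F x + G x)"
| mult: "smooth_expr m F \<Longrightarrow> smooth_expr m G \<Longrightarrow> smooth_expr m (\<lambda>x. F x * G x)"
| flat: "smooth_expr m F \<Longrightarrow> smooth_expr m (\<lambda>x. flat P (F x))"

lemma smooth_expr_continuous:
  "smooth_expr m F \<Longrightarrow> continuous_map (powertop_real UNIV) euclideanreal F"
proof (induction rule: smooth_expr.induct)
  case (coord i)
  then show ?case by (metis UNIV_I continuous_map_product_coordinates)
next
  case (flat F P)
  have "continuous_on UNIV (flat P)"
    by (meson DERIV_continuous_on flat_has_derivative has_field_derivative_at_within)
  then have "continuous_map euclideanreal euclideanreal (flat P)" by simp
  from continuous_map_compose[OF flat.IH this] show ?case by (simp add: o_def)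
qed (auto intro: continuous_intros)

lemma smooth_expr_partial:
  "smooth_expr m F \<Longrightarrow>
    \<exists>G. smooth_expr m G \<and> (\<forall>x. ((\<lambda>t. F (x(i := t))) has_real_derivative G x) (at (x i)))"
proof (induction rule: smooth_expr.induct)
  case (const c)
  show ?case by (intro exI[of _ "\<lambda>x. 0"]) (auto intro: smooth_expr.const)
next
  case (coord j)
  show ?case
  proof (cases "i = j")
    case True
    then show ?thesis by (intro exI[of _ "\<lambda>x. 1"]) (auto intro: smooth_expr.const)
  next
    case False
    then show ?thesis by (intro exI[of _ "\<lambda>x. 0"]) (auto intro: smooth_expr.const)
  qed
next
  case (add F G)
  then obtain F' G' where "smooth_expr m F'" "smooth_expr m G'"
    "\<forall>x. ((\<lambda>t. F (x(i := t))) has_real_derivative F' x) (at (x i))"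
    "\<forall>x. ((\<lambda>t. G (x(i := t))) has_real_derivative G' x) (at (x i))" by blast
  then show ?case
    by (intro exI[of _ "\<lambda>x. F' x + G' x"]) (auto intro: smooth_expr.add DERIV_add simp del: fun_upd_apply)
next
  case (mult F G)
  then obtain F' G' where *: "smooth_expr m F'" "smooth_expr m G'"
    "\<forall>x. ((\<lambda>t. F (x(i := t))) has_real_derivative F' x) (at (x i))"
    "\<forall>x. ((\<lambda>t. G (x(i := t))) has_real_derivative G' x) (at (x i))" by blast
  have "((\<lambda>t. F (x(i := t)) * G (x(i := t))) has_real_derivative F' x * G x + G' x * F x) (at (x i))" for x
    using DERIV_mult[OF *(3)[rule_format, of x] *(4)[rule_format, of x]] by simp
  then show ?case using * mult.hyps
    by (intro exI[of _ "\<lambda>x. F' x * G x + G' x * F x"]) (auto intro: smooth_expr.intros simp del: fun_upd_apply)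
next
  case (flat F P)
  then obtain F' where *: "smooth_expr m F'"
    "\<forall>x. ((\<lambda>t. F (x(i := t))) has_real_derivative F' x) (at (x i))" by blast
  have "((\<lambda>t. flat P (F (x(i := t)))) has_real_derivative flat (flat_deriv P) (F x) * F' x) (at (x i))" for x
    using DERIV_chain2[OF flat_has_derivative *(2)[rule_format, of x], of P] by simp
  then show ?case using * flat.hyps
    by (intro exI[of _ "\<lambda>x. flat (flat_deriv P) (F x) * F' x"])
      (auto intro: smooth_expr.mult smooth_expr.flat simp del: fun_upd_apply)
qed

lemma smooth_expr_smooth_on:
  assumes "smooth_expr m F"
  shows "smooth_on m U F"
proof -
  have "Ck_on m k U F" if "smooth_expr m F" for k F
    using that
  proof (induction k arbitrary: F)
    case 0
    then show ?case
      using smooth_expr_continuous[OF 0] by (simp add: Euclidean_space_def continuous_map_from_subtopology)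
  next
    case (Suc k)
    have "continuous_map (subtopology (Euclidean_space m) U) euclideanreal F"
      using smooth_expr_continuous[OF Suc.prems]
      by (simp add: Euclidean_space_def continuous_map_from_subtopology)
    moreover have "\<exists>g. (\<forall>x\<in>U. ((\<lambda>t. F (x(i := t))) has_real_derivative g x) (at (x i))) \<and> Ck_on m k U g" for i
      using smooth_expr_partial[OF Suc.prems, of i] Suc.IH by blast
    ultimately show ?case unfolding Ck_on.simps by blast
  qed
  then show ?thesis using assms by (simp add: smooth_on_def)
qed

lemma flat_1_mono: "s \<le> t \<Longrightarrow> flat 1 s \<le> flat 1 t"
  by (auto simp: flat_def frac_le)

lemma flat_1_pos: "0 < t \<Longrightarrow> 0 < flat 1 t"
  by (simp add: flat_def)

lemma smooth_expr_sum: "finite I \<Longrightarrow> (\<And>i. i \<in> I \<Longrightarrow> smooth_expr m (F i)) \<Longrightarrow> smooth_expr m (\<lambda>x. \<Sum>i\<in>I. F i x)"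
  by (induction rule: finite_induct) (auto intro: smooth_expr.intros)

text \<open>
  With \<open>\<rho>\<close> the squared distance to \<open>a\<close> and \<open>s = (\<rho> - \<delta>)/\<delta>\<close>, the bump function is a multiple of
  \<open>flat 1 (exp (- 1) - flat 1 s)\<close>: it is constant and positive where \<open>\<rho> \<le> \<delta>\<close>, since then \<open>flat 1 s = 0\<close>, and zero where
  \<open>\<rho> \<ge> 2 \<delta>\<close>, since then \<open>flat 1 s \<ge> flat 1 1 = exp (- 1)\<close>.
\<close>

lemma bump_function:
  assumes U: "openin (Euclidean_space m) U" and a: "a \<in> U"
  obtains b W K where "smooth_expr m b" "openin (Euclidean_space m) W" "compactin (Euclidean_space m) K"
    "a \<in> W" "W \<subseteq> K" "K \<subseteq> U" "\<And>x. x \<in> W \<Longrightarrow> b x = 1"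
    "\<And>x. x \<in> topspace (Euclidean_space m) - K \<Longrightarrow> b x = 0"
proof -
  let ?E = "{x :: nat \<Rightarrow> real. \<forall>i\<ge>m. x i = 0}"
  obtain T where T: "openin (powertop_real UNIV) T" "U = T \<inter> ?E"
    using U by (auto simp: Euclidean_space_def openin_subtopology)
  obtain B where B: "a \<in> Pi\<^sub>E UNIV B" "\<And>i. open (B i)" "Pi\<^sub>E UNIV B \<subseteq> T"
    using product_topology_open_contains_basis[OF T(1), of a] a T(2) by auto
  have "\<exists>e>0. \<forall>t. \<bar>t - a i\<bar> \<le> e \<longrightarrow> t \<in> B i" for i
  proof -
    have "a i \<in> B i" using B(1) by auto
    then obtain e where "e > 0" "cball (a i) e \<subseteq> B i"
      using B(2) open_contains_cball by blast
    then show ?thesis by (intro exI[of _ e]) (auto simp: cball_def dist_real_def abs_minus_commute)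
  qed
  then obtain e where e: "\<And>i. e i > 0" "\<And>i t. \<bar>t - a i\<bar> \<le> e i \<Longrightarrow> t \<in> B i" by metis
  \<comment> \<open>Only the coordinates below \<open>m\<close> vary in Euclidean space, so one bound serves for all of them.\<close>
  define \<epsilon> where "\<epsilon> = Min (insert 1 (e ` {..<m}))"
  have \<epsilon>: "\<epsilon> > 0" "\<And>i. i < m \<Longrightarrow> \<epsilon> \<le> e i"
    unfolding \<epsilon>_def using e(1) by (auto intro!: Min_le)
  define \<delta> where "\<delta> = \<epsilon>\<^sup>2 / 2"
  have \<delta>: "\<delta> > 0" using \<epsilon> by (simp add: \<delta>_def)
  define \<rho> where "\<rho> = (\<lambda>x. \<Sum>i<m. (x i + - a i) * (x i + - a i))"
  have \<rho>: "smooth_expr m \<rho>" unfolding \<rho>_def by (intro smooth_expr_sum smooth_expr.intros) auto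
  define b where "b = (\<lambda>x. inverse (flat 1 (exp (- 1))) *
     flat 1 (exp (- 1) + (- 1) * flat 1 (inverse \<delta> * (\<rho> x + - \<delta>))))"
  define W where "W = {x \<in> topspace (Euclidean_space m). \<rho> x < \<delta>}"
  define K where "K = {x \<in> topspace (Euclidean_space m). \<rho> x \<le> 2 * \<delta>}"
  define Q where "Q = Pi\<^sub>E UNIV (\<lambda>i. if i < m then {a i - \<epsilon>..a i + \<epsilon>} else {0})"
  have cont: "continuous_map (Euclidean_space m) euclideanreal \<rho>"
    using smooth_expr_continuous[OF \<rho>] by (simp add: Euclidean_space_def continuous_map_from_subtopology)
  \<comment> \<open>The cube \<open>Q\<close> of side \<open>2 \<epsilon>\<close> around \<open>a\<close> is compact and contains \<open>K\<close>, since \<open>2 \<delta> = \<epsilon>\<^sup>2\<close>.\<close>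
  have KQ: "K \<subseteq> Q"
  proof
    fix x assume x: "x \<in> K"
    have "\<bar>x i - a i\<bar> \<le> \<epsilon>" if "i < m" for i
    proof -
      have "(x i - a i)\<^sup>2 \<le> \<rho> x" unfolding \<rho>_def using that
        by (intro order_trans[OF _ member_le_sum[of i]]) (auto simp: power2_eq_square)
      also have "\<dots> \<le> \<epsilon>\<^sup>2" using x by (simp add: K_def \<delta>_def)
      finally show ?thesis using \<epsilon>(1) abs_le_square_iff[of "x i - a i" \<epsilon>] by simp
    qed
    then show "x \<in> Q" using x by (fastforce simp: Q_def K_def topspace_Euclidean_space abs_le_iff)
  qed
  have aE: "a \<in> ?E" using a T by auto
  have QU: "Q \<subseteq> U"
  proof
    fix x assume x: "x \<in> Q"
    have x': "i < m \<Longrightarrow> \<bar>x i - a i\<bar> \<le> \<epsilon>" "m \<le> i \<Longrightarrow> x i = 0" for i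
    proof -
      have *: "x i \<in> (if i < m then {a i - \<epsilon>..a i + \<epsilon>} else {0})"
        using x unfolding Q_def by blast
      show "\<bar>x i - a i\<bar> \<le> \<epsilon>" if "i < m" using * that by (simp add: abs_le_iff)
      show "x i = 0" if "m \<le> i" using * that by simp
    qed
    have "x i \<in> B i" for i
    proof (cases "i < m")
      case True
      then show ?thesis using x'(1) \<epsilon>(2) e(2) by (meson order_trans)
    next
      case False
      then have "x i = a i" using x'(2) aE by auto
      then show ?thesis using B(1) by auto
    qed
    then show "x \<in> U" using B(3) T(2) x'(2) by auto
  qed
  have "compactin (powertop_real UNIV) Q"
    unfolding Q_def by (auto simp: compactin_PiE)
  then have "compactin (Euclidean_space m) Q"
    unfolding Euclidean_space_def compactin_subtopology using QU T(2) by auto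
  moreover have "closedin (Euclidean_space m) K"
    unfolding K_def using closedin_continuous_map_preimage[OF cont, of "{..2*\<delta>}"] by simp
  ultimately have "compactin (Euclidean_space m) K"
    using KQ closed_compactin by blast
  moreover have "openin (Euclidean_space m) W"
    unfolding W_def using openin_continuous_map_preimage[OF cont, of "{..<\<delta>}"] by simp
  moreover have "a \<in> W" using \<delta> a openin_subset[OF U] by (auto simp: W_def \<rho>_def)
  moreover have "b x = 1" if "x \<in> W" for x
  proof -
    have "inverse \<delta> * (\<rho> x + - \<delta>) \<le> 0"
      using that \<delta> by (auto simp: W_def mult_le_0_iff)
    then have "flat 1 (inverse \<delta> * (\<rho> x + - \<delta>)) = 0" by (simp add: flat_def)
    then show ?thesis using flat_1_pos[of "exp (- 1)"] by (simp add: b_def)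
  qed
  moreover have "b x = 0" if "x \<in> topspace (Euclidean_space m) - K" for x
  proof -
    have "1 \<le> inverse \<delta> * (\<rho> x + - \<delta>)"
      using that \<delta> by (auto simp: K_def field_simps)
    then have "flat 1 1 \<le> flat 1 (inverse \<delta> * (\<rho> x + - \<delta>))" by (rule flat_1_mono)
    moreover have "flat 1 1 = exp (- 1)" by (simp add: flat_def)
    ultimately have "\<not> exp (- 1) + (- 1) * flat 1 (inverse \<delta> * (\<rho> x + - \<delta>)) > 0" by linarith
    then show ?thesis by (simp add: b_def flat_def)
  qed
  moreover have "smooth_expr m b" unfolding b_def by (intro smooth_expr.intros \<rho>)
  moreover have "W \<subseteq> K" using \<delta> by (auto simp: W_def K_def)
  moreover have "K \<subseteq> U" using KQ QU by blast
  ultimately show ?thesis using that by blast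
qed

section \<open>Sections of a sheaf of graded vector spaces\<close>

lemma cring_real_ring: "cring real_ring"
  by (rule cringI; (rule abelian_groupI comm_monoidI)?)
    (auto simp: real_ring_def algebra_simps intro: exI[of _ "- x" for x])

context gvs_sheaf
begin

lemma sec_abelian_group: "openin X U \<Longrightarrow> abelian_group (Sec S U j)"
  using vs module.axioms(2) by blast

lemma zero_sec [intro]: "openin X U \<Longrightarrow> \<zero>\<^bsub>Sec S U j\<^esub> \<in> secs S U j"
  by (rule abelian_monoid.zero_closed[OF abelian_group.axioms(1)[OF sec_abelian_group]])

lemma add_sec [intro]:
  "\<lbrakk>openin X U; s \<in> secs S U j; t \<in> secs S U j\<rbrakk> \<Longrightarrow> s \<oplus>\<^bsub>Sec S U j\<^esub> t \<in> secs S U j"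
  by (rule abelian_monoid.a_closed[OF abelian_group.axioms(1)[OF sec_abelian_group]])

lemma smult_sec [intro]:
  "\<lbrakk>openin X U; s \<in> secs S U j\<rbrakk> \<Longrightarrow> c \<odot>\<^bsub>Sec S U j\<^esub> s \<in> secs S U j"
  using module.smult_closed[OF vs] by (simp add: real_ring_def)

lemma sec_assoc: "\<lbrakk>openin X U; s \<in> secs S U j; t \<in> secs S U j; u \<in> secs S U j\<rbrakk> \<Longrightarrow>
    (s \<oplus>\<^bsub>Sec S U j\<^esub> t) \<oplus>\<^bsub>Sec S U j\<^esub> u = s \<oplus>\<^bsub>Sec S U j\<^esub> (t \<oplus>\<^bsub>Sec S U j\<^esub> u)"
  by (rule abelian_monoid.a_assoc[OF abelian_group.axioms(1)[OF sec_abelian_group]])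

lemma sec_comm: "\<lbrakk>openin X U; s \<in> secs S U j; t \<in> secs S U j\<rbrakk> \<Longrightarrow>
    s \<oplus>\<^bsub>Sec S U j\<^esub> t = t \<oplus>\<^bsub>Sec S U j\<^esub> s"
  by (rule abelian_monoid.a_comm[OF abelian_group.axioms(1)[OF sec_abelian_group]])

lemma sec_lcomm: "\<lbrakk>openin X U; s \<in> secs S U j; t \<in> secs S U j; u \<in> secs S U j\<rbrakk> \<Longrightarrow>
    s \<oplus>\<^bsub>Sec S U j\<^esub> (t \<oplus>\<^bsub>Sec S U j\<^esub> u) = t \<oplus>\<^bsub>Sec S U j\<^esub> (s \<oplus>\<^bsub>Sec S U j\<^esub> u)"
  by (metis sec_assoc sec_comm)

lemma sec_zero_left: "\<lbrakk>openin X U; s \<in> secs S U j\<rbrakk> \<Longrightarrow> \<zero>\<^bsub>Sec S U j\<^esub> \<oplus>\<^bsub>Sec S U j\<^esub> s = s"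
  by (rule abelian_monoid.l_zero[OF abelian_group.axioms(1)[OF sec_abelian_group]])

lemma sec_zero_right: "\<lbrakk>openin X U; s \<in> secs S U j\<rbrakk> \<Longrightarrow> s \<oplus>\<^bsub>Sec S U j\<^esub> \<zero>\<^bsub>Sec S U j\<^esub> = s"
  by (rule abelian_monoid.r_zero[OF abelian_group.axioms(1)[OF sec_abelian_group]])

lemma smult_smult: "\<lbrakk>openin X U; s \<in> secs S U j\<rbrakk> \<Longrightarrow>
    a \<odot>\<^bsub>Sec S U j\<^esub> (b \<odot>\<^bsub>Sec S U j\<^esub> s) = (a * b) \<odot>\<^bsub>Sec S U j\<^esub> s"
  using module.smult_assoc1[OF vs, of U a b] by (simp add: real_ring_def)

lemma smult_one: "\<lbrakk>openin X U; s \<in> secs S U j\<rbrakk> \<Longrightarrow> 1 \<odot>\<^bsub>Sec S U j\<^esub> s = s"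
  using module.smult_one[OF vs] by (simp add: real_ring_def)

lemma smult_add_left: "\<lbrakk>openin X U; s \<in> secs S U j\<rbrakk> \<Longrightarrow>
    (a + b) \<odot>\<^bsub>Sec S U j\<^esub> s = a \<odot>\<^bsub>Sec S U j\<^esub> s \<oplus>\<^bsub>Sec S U j\<^esub> b \<odot>\<^bsub>Sec S U j\<^esub> s"
  using module.smult_l_distr[OF vs, of U a b] by (simp add: real_ring_def)

lemma smult_add_right: "\<lbrakk>openin X U; s \<in> secs S U j; t \<in> secs S U j\<rbrakk> \<Longrightarrow>
    a \<odot>\<^bsub>Sec S U j\<^esub> (s \<oplus>\<^bsub>Sec S U j\<^esub> t) = a \<odot>\<^bsub>Sec S U j\<^esub> s \<oplus>\<^bsub>Sec S U j\<^esub> a \<odot>\<^bsub>Sec S U j\<^esub> t"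
  using module.smult_r_distr[OF vs, of U a] by (simp add: real_ring_def)

lemma smult_zero_left: "\<lbrakk>openin X U; s \<in> secs S U j\<rbrakk> \<Longrightarrow> 0 \<odot>\<^bsub>Sec S U j\<^esub> s = \<zero>\<^bsub>Sec S U j\<^esub>"
  using module.smult_l_null[OF vs] by (simp add: real_ring_def)

lemma smult_zero_right: "openin X U \<Longrightarrow> c \<odot>\<^bsub>Sec S U j\<^esub> \<zero>\<^bsub>Sec S U j\<^esub> = \<zero>\<^bsub>Sec S U j\<^esub>"
  using module.smult_r_null[OF vs, of U c] by (simp add: real_ring_def)

lemma minus_eq_smult: "\<lbrakk>openin X U; s \<in> secs S U j; t \<in> secs S U j\<rbrakk> \<Longrightarrow>
    s \<ominus>\<^bsub>Sec S U j\<^esub> t = s \<oplus>\<^bsub>Sec S U j\<^esub> (- 1) \<odot>\<^bsub>Sec S U j\<^esub> t"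
proof -
  assume *: "openin X U" "s \<in> secs S U j" "t \<in> secs S U j"
  have "t \<oplus>\<^bsub>Sec S U j\<^esub> (- 1) \<odot>\<^bsub>Sec S U j\<^esub> t = \<zero>\<^bsub>Sec S U j\<^esub>"
    using smult_add_left[OF *(1,3), of 1 "- 1"] by (simp add: smult_one smult_zero_left *)
  then have "\<ominus>\<^bsub>Sec S U j\<^esub> t = (- 1) \<odot>\<^bsub>Sec S U j\<^esub> t"
    by (metis *(1,3) abelian_group.minus_equality sec_abelian_group sec_comm smult_sec)
  then show ?thesis by (simp add: a_minus_def)
qed

lemma diff_eq_zero_iff: "\<lbrakk>openin X U; s \<in> secs S U j; t \<in> secs S U j\<rbrakk> \<Longrightarrow>
    s \<oplus>\<^bsub>Sec S U j\<^esub> (- 1) \<odot>\<^bsub>Sec S U j\<^esub> t = \<zero>\<^bsub>Sec S U j\<^esub> \<longleftrightarrow> s = t"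
proof
  assume *: "openin X U" "s \<in> secs S U j" "t \<in> secs S U j"
  have t: "(- 1) \<odot>\<^bsub>Sec S U j\<^esub> t \<oplus>\<^bsub>Sec S U j\<^esub> t = \<zero>\<^bsub>Sec S U j\<^esub>"
    using smult_add_left[OF *(1,3), of "- 1" 1] by (simp add: smult_one smult_zero_left *)
  show "s = t" if "s \<oplus>\<^bsub>Sec S U j\<^esub> (- 1) \<odot>\<^bsub>Sec S U j\<^esub> t = \<zero>\<^bsub>Sec S U j\<^esub>"
    by (metis * t that sec_assoc sec_zero_left sec_zero_right smult_sec)
  show "s \<oplus>\<^bsub>Sec S U j\<^esub> (- 1) \<odot>\<^bsub>Sec S U j\<^esub> t = \<zero>\<^bsub>Sec S U j\<^esub>" if "s = t"
    using * t that sec_comm smult_sec by metis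
qed

lemmas sec_algebra = sec_assoc sec_comm sec_lcomm sec_zero_left sec_zero_right smult_smult smult_one
  smult_add_right smult_zero_left smult_zero_right

end

lemma rlinearD:
  assumes "rlinear A B f"
  shows "x \<in> carrier A \<Longrightarrow> f x \<in> carrier B"
    and "\<lbrakk>x \<in> carrier A; y \<in> carrier A\<rbrakk> \<Longrightarrow> f (x \<oplus>\<^bsub>A\<^esub> y) = f x \<oplus>\<^bsub>B\<^esub> f y"
    and "x \<in> carrier A \<Longrightarrow> f (c \<odot>\<^bsub>A\<^esub> x) = c \<odot>\<^bsub>B\<^esub> f x"
  using assms by (auto simp: rlinear_def)

lemma rlinear_zero:
  assumes "rlinear A B f" "module real_ring A" "module real_ring B"
  shows "f \<zero>\<^bsub>A\<^esub> = \<zero>\<^bsub>B\<^esub>"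
proof -
  have z: "\<zero>\<^bsub>A\<^esub> \<in> carrier A"
    using assms(2) by (meson abelian_group.axioms(1) abelian_monoid.zero_closed module.axioms(2))
  have "0 \<odot>\<^bsub>A\<^esub> \<zero>\<^bsub>A\<^esub> = \<zero>\<^bsub>A\<^esub>" "0 \<odot>\<^bsub>B\<^esub> f \<zero>\<^bsub>A\<^esub> = \<zero>\<^bsub>B\<^esub>"
    using module.smult_l_null[OF assms(2) z] module.smult_l_null[OF assms(3) rlinearD(1)[OF assms(1) z]]
    by (simp_all add: real_ring_def)
  then show ?thesis using rlinearD(3)[OF assms(1) z, of 0] by simp
qed

context gvs_sheaf
begin

lemma rst_sec [intro]: "\<lbrakk>openin X U; openin X V; V \<subseteq> U; s \<in> secs S U j\<rbrakk> \<Longrightarrow> rst S U V j s \<in> secs S V j"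
  by (rule rlinearD(1)[OF rst_linear])

lemma rst_add: "\<lbrakk>openin X U; openin X V; V \<subseteq> U; s \<in> secs S U j; t \<in> secs S U j\<rbrakk> \<Longrightarrow>
    rst S U V j (s \<oplus>\<^bsub>Sec S U j\<^esub> t) = rst S U V j s \<oplus>\<^bsub>Sec S V j\<^esub> rst S U V j t"
  by (rule rlinearD(2)[OF rst_linear])

lemma rst_smult: "\<lbrakk>openin X U; openin X V; V \<subseteq> U; s \<in> secs S U j\<rbrakk> \<Longrightarrow>
    rst S U V j (c \<odot>\<^bsub>Sec S U j\<^esub> s) = c \<odot>\<^bsub>Sec S V j\<^esub> rst S U V j s"
  by (rule rlinearD(3)[OF rst_linear])

lemma rst_zero: "\<lbrakk>openin X U; openin X V; V \<subseteq> U\<rbrakk> \<Longrightarrow> rst S U V j \<zero>\<^bsub>Sec S U j\<^esub> = \<zero>\<^bsub>Sec S V j\<^esub>"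
  by (rule rlinear_zero[OF rst_linear vs vs])

text \<open>
  The sheaf axioms in two forms that are easier to apply: separatedness in terms of neighbourhoods
  of points, and gluing of indexed families.
\<close>

lemma sec_eqI_local:
  assumes U: "openin X U" and st: "s \<in> secs S U j" "t \<in> secs S U j"
    and loc: "\<And>x. x \<in> U \<Longrightarrow> \<exists>W. openin X W \<and> x \<in> W \<and> W \<subseteq> U \<and> rst S U W j s = rst S U W j t"
  shows "s = t"
proof -
  define \<V> where "\<V> = {W. openin X W \<and> W \<subseteq> U \<and> rst S U W j s = rst S U W j t}"
  have "\<Union>\<V> = U" unfolding \<V>_def using loc by blast
  then show ?thesis using separated[of \<V> s j t] st by (auto simp: \<V>_def)
qed

lemma glue_family:
  assumes open_A: "\<And>i. i \<in> I \<Longrightarrow> openin X (A i)" and secs: "\<And>i. i \<in> I \<Longrightarrow> \<sigma> i \<in> secs S (A i) j"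
    and agree: "\<And>i k. \<lbrakk>i \<in> I; k \<in> I\<rbrakk> \<Longrightarrow>
      rst S (A i) (A i \<inter> A k) j (\<sigma> i) = rst S (A k) (A i \<inter> A k) j (\<sigma> k)"
  shows "\<exists>s\<in>secs S (\<Union>(A ` I)) j. \<forall>i\<in>I. rst S (\<Union>(A ` I)) (A i) j s = \<sigma> i"
proof -
  define c where "c V = (SOME i. i \<in> I \<and> A i = V)" for V
  have c: "c (A i) \<in> I" "A (c (A i)) = A i" if "i \<in> I" for i
    using someI_ex[of "\<lambda>k. k \<in> I \<and> A k = A i"] that by (auto simp: c_def)
  \<comment> \<open>Equal members of the cover carry equal sections, as they agree on the intersection.\<close>
  have ceq: "\<sigma> (c (A i)) = \<sigma> i" if "i \<in> I" for i
    using agree[OF c(1)[OF that] that] rst_id[OF open_A[OF that]] secs[OF that] secs[OF c(1)[OF that]] c(2)[OF that]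
    by simp
  have "\<exists>s\<in>secs S (\<Union>(A ` I)) j. \<forall>V\<in>A ` I. rst S (\<Union>(A ` I)) V j s = \<sigma> (c V)"
    by (rule gluing) (auto simp: open_A secs ceq intro!: agree)
  then show ?thesis using ceq by auto
qed

text \<open>A section over \<open>V\<close> that vanishes on \<open>V \<inter> Z\<close> extends by zero to \<open>U = V \<union> (U \<inter> Z)\<close>.\<close>

lemma extend_by_zero:
  assumes U: "openin X U" and V: "openin X V" "V \<subseteq> U" and Z: "openin X Z" "U \<subseteq> V \<union> Z"
    and a: "a \<in> secs S V j" "rst S V (V \<inter> Z) j a = \<zero>\<^bsub>Sec S (V \<inter> Z) j\<^esub>"
  obtains b where "b \<in> secs S U j" "rst S U V j b = a" "rst S U (U \<inter> Z) j b = \<zero>\<^bsub>Sec S (U \<inter> Z) j\<^esub>"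
proof -
  define A where "A i = (if i then V else U \<inter> Z)" for i
  define \<sigma> where "\<sigma> i = (if i then a else \<zero>\<^bsub>Sec S (U \<inter> Z) j\<^esub>)" for i
  have UZ: "openin X (U \<inter> Z)" and VZ: "openin X (V \<inter> Z)" using U V Z by auto
  have eq: "V \<inter> (U \<inter> Z) = V \<inter> Z" "U \<inter> Z \<inter> V = V \<inter> Z" using V by auto
  have UN: "(\<Union>i. A i) = U" using V Z by (auto simp: A_def split: if_splits)
  have "\<exists>s\<in>secs S (\<Union>i. A i) j. \<forall>i\<in>UNIV. rst S (\<Union>i. A i) (A i) j s = \<sigma> i"
  proof (rule glue_family)
    show "openin X (A i)" for i using UZ V by (simp add: A_def)
    show "\<sigma> i \<in> secs S (A i) j" for i using UZ a(1) by (auto simp: \<sigma>_def A_def)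
    show "rst S (A i) (A i \<inter> A k) j (\<sigma> i) = rst S (A k) (A i \<inter> A k) j (\<sigma> k)" for i k
      using a(2) rst_zero[OF UZ VZ] Int_mono[OF V(2) subset_refl[of Z]]
      by (auto simp: \<sigma>_def A_def eq)
  qed
  then obtain s where "s \<in> secs S U j" "\<And>i. rst S U (A i) j s = \<sigma> i" by (auto simp: UN)
  from this(1) this(2)[of True] this(2)[of False] show ?thesis
    by (auto simp: A_def \<sigma>_def intro: that)
qed

end

section \<open>Cutoff functions on a graded manifold\<close>

text \<open>
  The partial derivatives in \<open>Ck_on\<close> are two-sided, so on an open set they depend only on the values there.
\<close>

lemma Ck_on_cong:
  assumes U: "openin (Euclidean_space m) U" and fg: "\<And>x. x \<in> U \<Longrightarrow> f x = g x" and f: "Ck_on m k U f"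
  shows "Ck_on m k U g"
proof -
  have cont: "continuous_map (subtopology (Euclidean_space m) U) euclideanreal g"
    if "continuous_map (subtopology (Euclidean_space m) U) euclideanreal f"
    using that by (rule continuous_map_eq) (simp add: fg)
  have deriv: "((\<lambda>t. g (x(i := t))) has_real_derivative D) (at (x i))"
    if D: "((\<lambda>t. f (x(i := t))) has_real_derivative D) (at (x i))" and x: "x \<in> U" and i: "i < m" for x i D
  proof -
    have xE: "\<forall>l\<ge>m. x l = 0" using openin_subset[OF U] x by (auto simp: topspace_Euclidean_space)
    have "continuous_map euclideanreal (powertop_real UNIV) (\<lambda>t. x(i := t))"
      by (auto simp: continuous_map_componentwise_UNIV)
    then have "continuous_map euclideanreal (Euclidean_space m) (\<lambda>t. x(i := t))"
      unfolding Euclidean_space_def continuous_map_in_subtopology using xE i by auto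
    from openin_continuous_map_preimage[OF this U] have "open {t. x(i := t) \<in> U}" by simp
    then have "eventually (\<lambda>t. x(i := t) \<in> U) (nhds (x i))"
      using eventually_nhds_in_open[of "{t. x(i := t) \<in> U}" "x i"] x by simp
    then have "eventually (\<lambda>t. f (x(i := t)) = g (x(i := t))) (nhds (x i))"
      by (rule eventually_mono) (rule fg)
    then show ?thesis using D DERIV_cong_ev[OF refl _ refl] by metis
  qed
  show ?thesis
  proof (cases k)
    case 0
    then show ?thesis using f cont by simp
  next
    case (Suc k')
    show ?thesis unfolding Suc Ck_on.simps
    proof (intro conjI allI impI)
      show "continuous_map (subtopology (Euclidean_space m) U) euclideanreal g"
        using f cont by (simp add: Suc)
      fix i assume i: "i < m"
      then obtain f' where f': "\<forall>x\<in>U. ((\<lambda>t. f (x(i := t))) has_real_derivative f' x) (at (x i))" "Ck_on m k' U f'"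
        using f unfolding Suc Ck_on.simps by blast
      have "\<forall>x\<in>U. ((\<lambda>t. g (x(i := t))) has_real_derivative f' x) (at (x i))"
        using f'(1) deriv[OF _ _ i] by blast
      then show "\<exists>g'. (\<forall>x\<in>U. ((\<lambda>t. g (x(i := t))) has_real_derivative g' x) (at (x i))) \<and> Ck_on m k' U g'"
        using f'(2) by blast
    qed
  qed
qed

lemma graded_chart_homeomorphism:
  assumes "graded_chart X n C V \<Omega> h \<phi>"
  shows "openin X V" "openin (Euclidean_space (n 0)) \<Omega>"
    "homeomorphic_map (subtopology X V) (subtopology (Euclidean_space (n 0)) \<Omega>) h"
  using assms[unfolded graded_chart_def] by (fast elim: conjE)+

lemma graded_chart_sections:
  assumes chart: "graded_chart X n C V \<Omega> h \<phi>" and W: "openin X W" "W \<subseteq> V"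
  shows "bij_betw (\<phi> W d) (secs C W d) (secs (model n) (h ` W) d)"
    and "rlinear (Sec C W d) (Sec (model n) (h ` W) d) (\<phi> W d)"
    and "\<phi> W 0 (gone C W) = gone (model n) (h ` W)"
    and "\<lbrakk>openin X W'; W' \<subseteq> W; f \<in> secs C W d\<rbrakk> \<Longrightarrow>
         \<phi> W' d (rst C W W' d f) = rst (model n) (h ` W) (h ` W') d (\<phi> W d f)"
proof -
  have "Q W" if "A \<and> B \<and> D \<and> (\<forall>W. openin X W \<and> W \<subseteq> V \<longrightarrow> Q W)" for A B D Q
    using that W by blast
  note iso = this[OF chart[unfolded graded_chart_def]]
  show "bij_betw (\<phi> W d) (secs C W d) (secs (model n) (h ` W) d)"
    by (rule iso[THEN conjunct1, THEN spec, THEN conjunct1])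
  show "rlinear (Sec C W d) (Sec (model n) (h ` W) d) (\<phi> W d)"
    by (rule iso[THEN conjunct1, THEN spec, THEN conjunct2])
  show "\<phi> W 0 (gone C W) = gone (model n) (h ` W)"
    by (rule iso[THEN conjunct2, THEN conjunct2, THEN conjunct1])
  show "\<phi> W' d (rst C W W' d f) = rst (model n) (h ` W) (h ` W') d (\<phi> W d f)"
    if "openin X W'" "W' \<subseteq> W" "f \<in> secs C W d"
    using iso[THEN conjunct2, THEN conjunct2, THEN conjunct2, THEN spec, THEN mp, THEN spec, THEN bspec]
      that by blast
qed

text \<open>
  Here \<open>Z\<close> is the complement of a closed set that contains the support of \<open>l\<close> and is contained in \<open>U\<close>.
\<close>

lemma (in graded_manifold) exists_cutoff:
  assumes U: "openin X U" and x: "x \<in> U"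
  shows "\<exists>l\<in>secs C (topspace X) 0. \<exists>W Z. openin X W \<and> x \<in> W \<and> W \<subseteq> U \<and>
    openin X Z \<and> U \<union> Z = topspace X \<and>
    rst C (topspace X) W 0 l = gone C W \<and> rst C (topspace X) Z 0 l = \<zero>\<^bsub>Sec C Z 0\<^esub>"
proof -
  have "x \<in> topspace X" using U x openin_subset by blast
  then obtain V \<Omega> h \<phi> where xV: "x \<in> V" and chart: "graded_chart X n C V \<Omega> h \<phi>"
    using charts[of x] by blast
  let ?E = "Euclidean_space (n 0)"
  have V: "openin X V" and \<Omega>: "openin ?E \<Omega>"
    and h: "homeomorphic_map (subtopology X V) (subtopology ?E \<Omega>) h"
    using graded_chart_homeomorphism[OF chart] by simp_all
  note bij = graded_chart_sections(1)[OF chart]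
    and lin = graded_chart_sections(2)[OF chart]
    and one = graded_chart_sections(3)[OF chart]
    and res = graded_chart_sections(4)[OF chart]
  have topV: "topspace (subtopology X V) = V" using openin_subset[OF V] by auto
  have top\<Omega>: "topspace (subtopology ?E \<Omega>) = \<Omega>" using openin_subset[OF \<Omega>] by auto
  have hV: "h ` V = \<Omega>" using homeomorphic_imp_surjective_map[OF h] topV top\<Omega> by simp
  have inj: "inj_on h V" using homeomorphic_imp_injective_map[OF h] topV by simp
  have open_h: "openin ?E (h ` A) \<longleftrightarrow> openin X A" if "A \<subseteq> V" for A
  proof -
    have "openin (subtopology ?E \<Omega>) (h ` A) \<longleftrightarrow> openin (subtopology X V) A"
      by (rule homeomorphic_map_openness[OF h]) (use topV that in simp)
    moreover have "h ` A \<subseteq> \<Omega>" using that hV by blast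
    ultimately show ?thesis
      using that openin_open_subtopology[OF V, of A] openin_open_subtopology[OF \<Omega>, of "h ` A"] by metis
  qed
  have "openin ?E (h ` (U \<inter> V))" using open_h[of "U \<inter> V"] U V by auto
  then obtain b W' K' where b: "smooth_expr (n 0) b" and W': "openin ?E W'" and K': "compactin ?E K'"
    and sub: "h x \<in> W'" "W' \<subseteq> K'" "K' \<subseteq> h ` (U \<inter> V)"
    and b1: "\<And>y. y \<in> W' \<Longrightarrow> b y = 1" and b0: "\<And>y. y \<in> topspace ?E - K' \<Longrightarrow> b y = 0"
    using bump_function[of "n 0" "h ` (U \<inter> V)" "h x"] x xV by auto
  define W where "W = {y \<in> V. h y \<in> W'}"
  define K where "K = {y \<in> V. h y \<in> K'}"
  define Z where "Z = topspace X - K"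
  have hW: "h ` W = W'" and hK: "h ` K = K'" using sub by (auto simp: W_def K_def)
  have WV: "W \<subseteq> V" and KV: "K \<subseteq> V" by (auto simp: W_def K_def)
  have KU: "K \<subseteq> U"
  proof
    fix y assume "y \<in> K"
    then have y: "y \<in> V" "h y \<in> h ` (U \<inter> V)" using sub(3) by (auto simp: K_def)
    then show "y \<in> U" using inj by (auto simp: inj_on_def)
  qed
  have W: "openin X W" using open_h[OF WV] W' hW by simp
  have "compactin (subtopology ?E \<Omega>) K'"
    using K' sub(3) hV by (auto simp: compactin_subtopology)
  then have "compactin (subtopology X V) K"
    using homeomorphic_map_compactness[OF h, of K, unfolded topV] KV hK by simp
  then have "compactin X K" by (simp add: compactin_subtopology)
  then have "closedin X K" by (rule compactin_imp_closedin[OF hausdorff])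
  then have Z: "openin X Z" by (auto simp: Z_def)
  have VZ: "openin X (V \<inter> Z)" using V Z by auto
  \<comment> \<open>The bump function is the coefficient of the monomial 1, the other coefficients are zero.\<close>
  define f where "f = (\<lambda>p\<in>midx n 0. \<lambda>y\<in>\<Omega>. if p = (\<lambda>v. 0) then b y else 0)"
  have smooth: "smooth_on (n 0) \<Omega> (\<lambda>y\<in>\<Omega>. if p = (\<lambda>v. 0) then b y else 0)" for p :: "int \<times> nat \<Rightarrow> nat"
  proof -
    have "smooth_expr (n 0) (\<lambda>y. if p = (\<lambda>v. 0) then b y else 0)"
      using b by (cases "p = (\<lambda>v. 0)") (auto intro: smooth_expr.const)
    from smooth_expr_smooth_on[OF this, of \<Omega>] show ?thesis
      unfolding smooth_on_def using Ck_on_cong[OF \<Omega>] by (metis (no_types, lifting) restrict_apply)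
  qed
  have "f \<in> secs (model n) (h ` V) 0"
    unfolding hV by (auto simp: model_def f_def smooth)
  then obtain g where g: "g \<in> secs C V 0" "\<phi> V 0 g = f"
    using bij[OF V subset_refl] unfolding bij_betw_def by (metis imageE)
  have "rst C V (V \<inter> Z) 0 g = \<zero>\<^bsub>Sec C (V \<inter> Z) 0\<^esub>"
  proof -
    have z: "\<zero>\<^bsub>Sec C (V \<inter> Z) 0\<^esub> \<in> secs C (V \<inter> Z) 0" using VZ by auto
    have sub': "h ` (V \<inter> Z) \<subseteq> \<Omega>" using hV by blast
    have "b y = 0" if "y \<in> h ` (V \<inter> Z)" for y
      using that hV openin_subset[OF \<Omega>] by (intro b0) (auto simp: Z_def K_def)
    then have "\<phi> (V \<inter> Z) 0 (rst C V (V \<inter> Z) 0 g) = \<zero>\<^bsub>Sec (model n) (h ` (V \<inter> Z)) 0\<^esub>"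
      using res[OF V subset_refl VZ _ g(1)] sub'
      by (auto simp: g(2) model_def f_def fun_eq_iff restrict_def)
    \<comment> \<open>\<open>\<phi>\<close> maps zero to zero; this is read off from homogeneity, so that the model need not be known to be a module.\<close>
    also have "\<dots> = 0 \<odot>\<^bsub>Sec (model n) (h ` (V \<inter> Z)) 0\<^esub> \<phi> (V \<inter> Z) 0 \<zero>\<^bsub>Sec C (V \<inter> Z) 0\<^esub>"
      by (simp add: model_def)
    also have "\<dots> = \<phi> (V \<inter> Z) 0 \<zero>\<^bsub>Sec C (V \<inter> Z) 0\<^esub>"
      using rlinearD(3)[OF lin[OF VZ] z, of 0] smult_zero_left[OF VZ z] by simp
    finally show ?thesis
      using bij[OF VZ] z rst_sec[OF V VZ _ g(1)] by (auto simp: bij_betw_def inj_on_def)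
  qed
  moreover have "topspace X \<subseteq> V \<union> Z" using KV by (auto simp: Z_def)
  ultimately obtain l where l: "l \<in> secs C (topspace X) 0" "rst C (topspace X) V 0 l = g"
      "rst C (topspace X) (topspace X \<inter> Z) 0 l = \<zero>\<^bsub>Sec C (topspace X \<inter> Z) 0\<^esub>"
    using extend_by_zero[OF openin_topspace V openin_subset[OF V] Z _ g(1)] by blast
  have "rst C (topspace X) W 0 l = rst C V W 0 g"
    using rst_rst[OF openin_topspace V W WV openin_subset[OF V] l(1)] l(2) by simp
  also have "\<dots> = gone C W"
  proof -
    have "W' \<subseteq> \<Omega>" using sub hV by blast
    then have "\<phi> W 0 (rst C V W 0 g) = gone (model n) (h ` W)"
      using res[OF V subset_refl W WV g(1)]
      by (auto simp: g(2) hW model_def f_def fun_eq_iff restrict_def b1)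
    then show ?thesis
      using bij[OF W WV] one[OF W WV] gone_closed[OF W] rst_sec[OF V W WV g(1)]
      by (auto simp: bij_betw_def inj_on_def)
  qed
  finally have "rst C (topspace X) W 0 l = gone C W" .
  moreover have "rst C (topspace X) Z 0 l = \<zero>\<^bsub>Sec C Z 0\<^esub>"
    using l(3) openin_subset[OF Z] by (simp add: Int_absorb1)
  moreover have "U \<union> Z = topspace X" using KU openin_subset[OF U] by (auto simp: Z_def)
  moreover have "x \<in> W" "W \<subseteq> U" using xV sub KU by (auto simp: W_def K_def)
  ultimately show ?thesis using l(1) W Z by blast
qed

section \<open>Graded maps and local operators\<close>

context gvs_sheaf
begin

lemma graded_maps_rlinear: "F \<in> graded_maps S U d \<Longrightarrow> rlinear (Sec S U j) (Sec S U (j + d)) (F j)"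
  by (simp add: graded_maps_def)

lemma graded_maps_sec: "\<lbrakk>F \<in> graded_maps S U d; s \<in> secs S U j\<rbrakk> \<Longrightarrow> F j s \<in> secs S U (j + d)"
  by (rule rlinearD(1)[OF graded_maps_rlinear])

lemma graded_maps_add: "\<lbrakk>F \<in> graded_maps S U d; s \<in> secs S U j; t \<in> secs S U j\<rbrakk> \<Longrightarrow>
    F j (s \<oplus>\<^bsub>Sec S U j\<^esub> t) = F j s \<oplus>\<^bsub>Sec S U (j + d)\<^esub> F j t"
  by (rule rlinearD(2)[OF graded_maps_rlinear])

lemma graded_maps_smult: "\<lbrakk>F \<in> graded_maps S U d; s \<in> secs S U j\<rbrakk> \<Longrightarrow>
    F j (c \<odot>\<^bsub>Sec S U j\<^esub> s) = c \<odot>\<^bsub>Sec S U (j + d)\<^esub> F j s"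
  by (rule rlinearD(3)[OF graded_maps_rlinear])

lemma graded_maps_zero: "\<lbrakk>openin X U; F \<in> graded_maps S U d\<rbrakk> \<Longrightarrow>
    F j \<zero>\<^bsub>Sec S U j\<^esub> = \<zero>\<^bsub>Sec S U (j + d)\<^esub>"
  by (rule rlinear_zero[OF graded_maps_rlinear vs vs])

lemma graded_mapsI:
  assumes "\<And>j s. s \<notin> secs S U j \<Longrightarrow> F j s = undefined"
    and "\<And>j s. s \<in> secs S U j \<Longrightarrow> F j s \<in> secs S U (j + d)"
    and "\<And>j s t. \<lbrakk>s \<in> secs S U j; t \<in> secs S U j\<rbrakk> \<Longrightarrow>
      F j (s \<oplus>\<^bsub>Sec S U j\<^esub> t) = F j s \<oplus>\<^bsub>Sec S U (j + d)\<^esub> F j t"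
    and "\<And>j c s. s \<in> secs S U j \<Longrightarrow> F j (c \<odot>\<^bsub>Sec S U j\<^esub> s) = c \<odot>\<^bsub>Sec S U (j + d)\<^esub> F j s"
  shows "F \<in> graded_maps S U d"
  using assms by (auto simp: graded_maps_def rlinear_def extensional_def)

lemma graded_maps_eqI:
  assumes "F \<in> graded_maps S U d" "G \<in> graded_maps S U d" "\<And>j s. s \<in> secs S U j \<Longrightarrow> F j s = G j s"
  shows "F = G"
proof (intro ext)
  fix j s
  show "F j s = G j s"
    using assms by (cases "s \<in> secs S U j") (auto simp: graded_maps_def extensional_def)
qed

lemma Loc_graded: "F \<in> Loc X S U d \<Longrightarrow> F \<in> graded_maps S U d"
  by (simp add: Loc_def)

lemma LocI:
  assumes "F \<in> graded_maps S U d"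
    and "\<And>V j s. \<lbrakk>openin X V; V \<subseteq> U; s \<in> secs S U j; rst S U V j s = \<zero>\<^bsub>Sec S V j\<^esub>\<rbrakk>
      \<Longrightarrow> rst S U V (j + d) (F j s) = \<zero>\<^bsub>Sec S V (j + d)\<^esub>"
  shows "F \<in> Loc X S U d"
  using assms by (simp add: Loc_def)

lemma Loc_vanish: "\<lbrakk>F \<in> Loc X S U d; openin X V; V \<subseteq> U; s \<in> secs S U j;
    rst S U V j s = \<zero>\<^bsub>Sec S V j\<^esub>\<rbrakk> \<Longrightarrow> rst S U V (j + d) (F j s) = \<zero>\<^bsub>Sec S V (j + d)\<^esub>"
  by (simp add: Loc_def)

lemma Loc_eq_local:
  assumes F: "F \<in> Loc X S U d" and U: "openin X U" and V: "openin X V" "V \<subseteq> U"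
    and st: "s \<in> secs S U j" "t \<in> secs S U j" "rst S U V j s = rst S U V j t"
  shows "rst S U V (j + d) (F j s) = rst S U V (j + d) (F j t)"
proof -
  note Fg = Loc_graded[OF F]
  let ?u = "s \<oplus>\<^bsub>Sec S U j\<^esub> (- 1) \<odot>\<^bsub>Sec S U j\<^esub> t"
  have mt: "(- 1) \<odot>\<^bsub>Sec S U j\<^esub> t \<in> secs S U j" using U st by auto
  have "rst S U V j ?u = \<zero>\<^bsub>Sec S V j\<^esub>"
    using U V st mt by (simp add: rst_add rst_smult diff_eq_zero_iff rst_sec)
  then have "rst S U V (j + d) (F j ?u) = \<zero>\<^bsub>Sec S V (j + d)\<^esub>"
    using F U V st mt by (intro Loc_vanish) auto
  moreover have "F j ?u = F j s \<oplus>\<^bsub>Sec S U (j + d)\<^esub> (- 1) \<odot>\<^bsub>Sec S U (j + d)\<^esub> F j t"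
    using st mt by (simp add: graded_maps_add[OF Fg] graded_maps_smult[OF Fg])
  ultimately show ?thesis
    using U V st by (simp add: rst_add rst_smult diff_eq_zero_iff rst_sec smult_sec graded_maps_sec[OF Fg])
qed

end

text \<open>
  The operations of \<open>op_sheaf X E H\<close>. None of them depends on \<open>H\<close>.
\<close>

definition op_rst :: "'x topology \<Rightarrow> ('x, 's, 'm) gvs_sheaf_scheme \<Rightarrow> 'x set \<Rightarrow> 'x set \<Rightarrow> int \<Rightarrow>
    (int \<Rightarrow> 's \<Rightarrow> 's) \<Rightarrow> int \<Rightarrow> 's \<Rightarrow> 's" where
  "op_rst X E U V d F = (THE G. G \<in> Loc X E V d \<and>
     (\<forall>j. \<forall>\<psi>\<in>secs E U j. rst E U V (j + d) (F j \<psi>) = G j (rst E U V j \<psi>)))"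

definition op_zero :: "('x, 's, 'm) gvs_sheaf_scheme \<Rightarrow> 'x set \<Rightarrow> int \<Rightarrow> int \<Rightarrow> 's \<Rightarrow> 's" where
  "op_zero E U d = (\<lambda>j. \<lambda>\<psi>\<in>secs E U j. \<zero>\<^bsub>Sec E U (j + d)\<^esub>)"

definition op_add :: "('x, 's, 'm) gvs_sheaf_scheme \<Rightarrow> 'x set \<Rightarrow> int \<Rightarrow>
    (int \<Rightarrow> 's \<Rightarrow> 's) \<Rightarrow> (int \<Rightarrow> 's \<Rightarrow> 's) \<Rightarrow> int \<Rightarrow> 's \<Rightarrow> 's" where
  "op_add E U d F G = (\<lambda>j. \<lambda>\<psi>\<in>secs E U j. F j \<psi> \<oplus>\<^bsub>Sec E U (j + d)\<^esub> G j \<psi>)"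

definition op_smult :: "('x, 's, 'm) gvs_sheaf_scheme \<Rightarrow> 'x set \<Rightarrow> int \<Rightarrow> real \<Rightarrow>
    (int \<Rightarrow> 's \<Rightarrow> 's) \<Rightarrow> int \<Rightarrow> 's \<Rightarrow> 's" where
  "op_smult E U d c F = (\<lambda>j. \<lambda>\<psi>\<in>secs E U j. c \<odot>\<^bsub>Sec E U (j + d)\<^esub> F j \<psi>)"

definition op_act :: "('x, 'a, 's, 'm) gmod_sheaf_scheme \<Rightarrow> 'x set \<Rightarrow> int \<Rightarrow> int \<Rightarrow> 'a \<Rightarrow>
    (int \<Rightarrow> 's \<Rightarrow> 's) \<Rightarrow> int \<Rightarrow> 's \<Rightarrow> 's" where
  "op_act E U i d f F = (\<lambda>j. \<lambda>\<psi>\<in>secs E U j. act E U i (j + d) f (F j \<psi>))"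

lemma op_sheaf_fields [simp]:
  "secs (op_sheaf X E H) U d = H U d"
  "\<zero>\<^bsub>Sec (op_sheaf X E H) U d\<^esub> = op_zero E U d"
  "F \<oplus>\<^bsub>Sec (op_sheaf X E H) U d\<^esub> G = op_add E U d F G"
  "c \<odot>\<^bsub>Sec (op_sheaf X E H) U d\<^esub> F = op_smult E U d c F"
  "rst (op_sheaf X E H) U V d F = op_rst X E U V d F"
  "act (op_sheaf X E H) U i d f F = op_act E U i d f F"
  by (simp_all add: op_sheaf_def op_zero_def op_add_def op_smult_def op_rst_def op_act_def)

lemma op_apply [simp]:
  assumes "\<psi> \<in> secs E U j"
  shows "op_zero E U d j \<psi> = \<zero>\<^bsub>Sec E U (j + d)\<^esub>"
    "op_add E U d F G j \<psi> = F j \<psi> \<oplus>\<^bsub>Sec E U (j + d)\<^esub> G j \<psi>"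
    "op_smult E U d c F j \<psi> = c \<odot>\<^bsub>Sec E U (j + d)\<^esub> F j \<psi>"
    "op_act E U i d f F j \<psi> = act E U i (j + d) f (F j \<psi>)"
  using assms by (simp_all add: op_zero_def op_add_def op_smult_def op_act_def)

lemma op_undefined:
  assumes "\<psi> \<notin> secs E U j"
  shows "op_zero E U d j \<psi> = undefined" "op_add E U d F G j \<psi> = undefined"
    "op_smult E U d c F j \<psi> = undefined" "op_act E U i d f F j \<psi> = undefined"
  using assms by (simp_all add: op_zero_def op_add_def op_smult_def op_act_def)

context gmod_sheaf
begin

lemma act_sec:
  "\<lbrakk>openin X U; f \<in> secs C U i; s \<in> secs S U j\<rbrakk> \<Longrightarrow> act S U i j f s \<in> secs S U (i + j)"
  by (rule rlinearD(1)[OF act_linear_right])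

lemma act_add_right: "\<lbrakk>openin X U; f \<in> secs C U i; s \<in> secs S U j; t \<in> secs S U j\<rbrakk> \<Longrightarrow>
    act S U i j f (s \<oplus>\<^bsub>Sec S U j\<^esub> t) = act S U i j f s \<oplus>\<^bsub>Sec S U (i + j)\<^esub> act S U i j f t"
  by (rule rlinearD(2)[OF act_linear_right])

lemma act_smult_right: "\<lbrakk>openin X U; f \<in> secs C U i; s \<in> secs S U j\<rbrakk> \<Longrightarrow>
    act S U i j f (c \<odot>\<^bsub>Sec S U j\<^esub> s) = c \<odot>\<^bsub>Sec S U (i + j)\<^esub> act S U i j f s"
  by (rule rlinearD(3)[OF act_linear_right])

lemma act_zero_right: "\<lbrakk>openin X U; f \<in> secs C U i\<rbrakk> \<Longrightarrow>
    act S U i j f \<zero>\<^bsub>Sec S U j\<^esub> = \<zero>\<^bsub>Sec S U (i + j)\<^esub>"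
  by (rule rlinear_zero[OF act_linear_right vs vs])

lemma act_add_left: "\<lbrakk>openin X U; f \<in> secs C U i; g \<in> secs C U i; s \<in> secs S U j\<rbrakk> \<Longrightarrow>
    act S U i j (f \<oplus>\<^bsub>Sec C U i\<^esub> g) s = act S U i j f s \<oplus>\<^bsub>Sec S U (i + j)\<^esub> act S U i j g s"
  by (rule rlinearD(2)[OF act_linear_left])

lemma act_smult_left: "\<lbrakk>openin X U; f \<in> secs C U i; s \<in> secs S U j\<rbrakk> \<Longrightarrow>
    act S U i j (c \<odot>\<^bsub>Sec C U i\<^esub> f) s = c \<odot>\<^bsub>Sec S U (i + j)\<^esub> act S U i j f s"
  by (rule rlinearD(3)[OF act_linear_left])

lemma act_zero_left: "\<lbrakk>openin X U; s \<in> secs S U j\<rbrakk> \<Longrightarrow>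
    act S U i j \<zero>\<^bsub>Sec C U i\<^esub> s = \<zero>\<^bsub>Sec S U (i + j)\<^esub>"
  by (rule rlinear_zero[OF act_linear_left alg.vs vs])

text \<open>Graded commutativity of the algebra, in terms of the action on a module:\<close>

lemma act_swap:
  assumes U: "openin X U" and "f \<in> secs C U i" "g \<in> secs C U j" "s \<in> secs S U l"
  shows "act S U i (j + l) f (act S U j l g s) =
    ((-1) powi (i * j)) \<odot>\<^bsub>Sec S U (i + (j + l))\<^esub> act S U j (i + l) g (act S U i l f s)"
proof -
  have "act S U (i + j) l (gmul C U i j f g) s =
      ((-1) powi (i * j)) \<odot>\<^bsub>Sec S U (i + j + l)\<^esub> act S U (i + j) l (gmul C U j i g f) s"
    using assms alg.gmul_comm[OF assms(1-3)] rlinearD(1)[OF alg.gmul_linear_right, OF U assms(3) assms(2)]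
    by (simp add: act_smult_left add.commute[of j i])
  then show ?thesis
    using act_assoc[OF assms] act_assoc[OF assms(1,3,2,4)] by (simp add: add.assoc add.commute[of j i])
qed

lemma op_zero_graded: "openin X U \<Longrightarrow> op_zero S U d \<in> graded_maps S U d"
  by (rule graded_mapsI)
    (simp_all add: op_undefined sec_zero_left smult_zero_right add_sec smult_sec zero_sec)

lemma op_graded_maps:
  assumes U: "openin X U" and F: "F \<in> graded_maps S U d" and G: "G \<in> graded_maps S U d"
  shows "op_add S U d F G \<in> graded_maps S U d" (is ?add)
    and "op_smult S U d c F \<in> graded_maps S U d" (is ?smult)
    and "f \<in> secs C U i \<Longrightarrow> op_act S U i d f F \<in> graded_maps S U (i + d)" (is "_ \<Longrightarrow> ?act")
proof -
  note [simp] = add_sec[OF U] smult_sec[OF U] zero_sec[OF U] graded_maps_sec[OF F] graded_maps_sec[OF G]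
    graded_maps_add[OF F] graded_maps_add[OF G] graded_maps_smult[OF F] graded_maps_smult[OF G]
    op_undefined
  show ?add by (rule graded_mapsI) (simp_all add: sec_algebra[OF U])
  show ?smult by (rule graded_mapsI) (simp_all add: sec_algebra[OF U] mult.commute)
  show ?act if f: "f \<in> secs C U i"
  proof (rule graded_mapsI)
    fix j s assume s: "s \<in> secs S U j"
    show "op_act S U i d f F j s \<in> secs S U (j + (i + d))"
      using act_sec[OF U f graded_maps_sec[OF F s]] s by (simp add: add.left_commute)
    show "op_act S U i d f F j (c \<odot>\<^bsub>Sec S U j\<^esub> s) = c \<odot>\<^bsub>Sec S U (j + (i + d))\<^esub> op_act S U i d f F j s" for c
      using act_smult_right[OF U f graded_maps_sec[OF F s]] s by (simp add: add.left_commute)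
    show "op_act S U i d f F j (s \<oplus>\<^bsub>Sec S U j\<^esub> t) =
        op_act S U i d f F j s \<oplus>\<^bsub>Sec S U (j + (i + d))\<^esub> op_act S U i d f F j t" if "t \<in> secs S U j" for t
      using act_add_right[OF U f graded_maps_sec[OF F s] graded_maps_sec[OF F that]] s that
      by (simp add: add.left_commute)
  qed simp
qed

lemma op_Loc:
  assumes U: "openin X U"
  shows op_zero_Loc: "op_zero S U d \<in> Loc X S U d"
    and op_add_Loc: "\<lbrakk>F \<in> Loc X S U d; G \<in> Loc X S U d\<rbrakk> \<Longrightarrow> op_add S U d F G \<in> Loc X S U d"
    and op_smult_Loc: "F \<in> Loc X S U d \<Longrightarrow> op_smult S U d c F \<in> Loc X S U d"
    and op_act_Loc: "\<lbrakk>F \<in> Loc X S U d; f \<in> secs C U i\<rbrakk> \<Longrightarrow> op_act S U i d f F \<in> Loc X S U (i + d)"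
proof -
  show "op_zero S U d \<in> Loc X S U d"
    by (rule LocI[OF op_zero_graded[OF U]]) (simp add: rst_zero[OF U])
  show "op_add S U d F G \<in> Loc X S U d" if F: "F \<in> Loc X S U d" and G: "G \<in> Loc X S U d"
  proof (rule LocI)
    show "op_add S U d F G \<in> graded_maps S U d"
      using op_graded_maps(1)[OF U] Loc_graded that by blast
  qed (simp add: rst_add[OF U] graded_maps_sec[OF Loc_graded[OF F]] graded_maps_sec[OF Loc_graded[OF G]]
      Loc_vanish[OF F] Loc_vanish[OF G] sec_zero_left zero_sec)
  show "op_smult S U d c F \<in> Loc X S U d" if F: "F \<in> Loc X S U d"
  proof (rule LocI)
    show "op_smult S U d c F \<in> graded_maps S U d"
      using op_graded_maps(2)[OF U] Loc_graded that by blast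
  qed (simp add: rst_smult[OF U] graded_maps_sec[OF Loc_graded[OF F]] Loc_vanish[OF F] smult_zero_right)
  show "op_act S U i d f F \<in> Loc X S U (i + d)" if F: "F \<in> Loc X S U d" and f: "f \<in> secs C U i"
  proof (rule LocI)
    show "op_act S U i d f F \<in> graded_maps S U (i + d)"
      using op_graded_maps(3)[OF U] Loc_graded that by blast
    fix V j s assume V: "openin X V" "V \<subseteq> U" and s: "s \<in> secs S U j" "rst S U V j s = \<zero>\<^bsub>Sec S V j\<^esub>"
    show "rst S U V (j + (i + d)) (op_act S U i d f F j s) = \<zero>\<^bsub>Sec S V (j + (i + d))\<^esub>"
      using rst_act[OF U V f graded_maps_sec[OF Loc_graded[OF F] s(1)]] Loc_vanish[OF F V s] s(1)
        act_zero_right[OF V(1) alg.rst_sec[OF U V f], of "j + d"]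
      by (simp add: add.left_commute)
  qed
qed

end

section \<open>Extension of sections by means of cutoffs\<close>

text \<open>
  Sheaves of graded modules over a sheaf of graded algebras that has cutoff functions: for each
  neighbourhood \<open>U\<close> of \<open>x\<close> there is a global function of degree 0 that is 1 on a neighbourhood \<open>W\<close> of \<open>x\<close>
  and 0 on an open set \<open>Z\<close> covering the complement of \<open>U\<close>.
\<close>

locale gmod_sheaf_with_cutoffs = gmod_sheaf X C E
  for X :: "'x topology" and C :: "('x, 'a, 'm) galg_sheaf_scheme"
    and E :: "('x, 'a, 's, 'l) gmod_sheaf_scheme" +
  assumes cutoff: "\<lbrakk>openin X U; x \<in> U\<rbrakk> \<Longrightarrow>
    \<exists>l\<in>secs C (topspace X) 0. \<exists>W Z. openin X W \<and> x \<in> W \<and> W \<subseteq> U \<and>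
      openin X Z \<and> U \<union> Z = topspace X \<and>
      rst C (topspace X) W 0 l = gone C W \<and> rst C (topspace X) Z 0 l = \<zero>\<^bsub>Sec C Z 0\<^esub>"
begin

lemma cutoff_on:
  assumes U: "openin X U" and V: "openin X V" "V \<subseteq> U" and x: "x \<in> V"
  obtains l W Z where "l \<in> secs C U 0" "openin X W" "x \<in> W" "W \<subseteq> V"
    "openin X Z" "Z \<subseteq> U" "U = V \<union> Z" "rst C U W 0 l = gone C W" "rst C U Z 0 l = \<zero>\<^bsub>Sec C Z 0\<^esub>"
proof -
  let ?T = "topspace X"
  obtain l W Z where l: "l \<in> secs C ?T 0" and W: "openin X W" "x \<in> W" "W \<subseteq> V"
    and Z: "openin X Z" "V \<union> Z = ?T"
    and l': "rst C ?T W 0 l = gone C W" "rst C ?T Z 0 l = \<zero>\<^bsub>Sec C Z 0\<^esub>"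
    using cutoff[OF V(1) x] by blast
  have UT: "U \<subseteq> ?T" using openin_subset[OF U] .
  have UZ: "openin X (U \<inter> Z)" using U Z by auto
  show ?thesis
  proof (rule that)
    show "rst C ?T U 0 l \<in> secs C U 0" using U UT l by auto
    show "rst C U W 0 (rst C ?T U 0 l) = gone C W"
      using alg.rst_rst[OF openin_topspace U W(1) _ UT l] W V l' by simp
    have "rst C U (U \<inter> Z) 0 (rst C ?T U 0 l) = rst C Z (U \<inter> Z) 0 (rst C ?T Z 0 l)"
      using alg.rst_rst[OF openin_topspace U UZ _ UT l]
        alg.rst_rst[OF openin_topspace Z(1) UZ _ openin_subset[OF Z(1)] l] by simp
    then show "rst C U (U \<inter> Z) 0 (rst C ?T U 0 l) = \<zero>\<^bsub>Sec C (U \<inter> Z) 0\<^esub>"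
      using alg.rst_zero[OF Z(1) UZ] l' by simp
    show "U = V \<union> U \<inter> Z" using Z V UT by blast
  qed (use W UZ in auto)
qed

lemma extend_section_locally:
  assumes U: "openin X U" and V: "openin X V" "V \<subseteq> U" and x: "x \<in> V" and s: "s \<in> secs E V j"
  obtains \<psi> W where "\<psi> \<in> secs E U j" "openin X W" "x \<in> W" "W \<subseteq> V" "rst E U W j \<psi> = rst E V W j s"
proof -
  obtain l W Z where l: "l \<in> secs C U 0" and W: "openin X W" "x \<in> W" "W \<subseteq> V"
    and Z: "openin X Z" "Z \<subseteq> U" "U = V \<union> Z"
    and l': "rst C U W 0 l = gone C W" "rst C U Z 0 l = \<zero>\<^bsub>Sec C Z 0\<^esub>"
    by (rule cutoff_on[OF U V x]) blast
  have VZ: "openin X (V \<inter> Z)" using V Z by auto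
  note lV = alg.rst_sec[OF U V l]
  let ?a = "act E V 0 j (rst C U V 0 l) s"
  have a: "?a \<in> secs E V j" using act_sec[OF V(1) lV s] by simp
  have "rst C V (V \<inter> Z) 0 (rst C U V 0 l) = rst C Z (V \<inter> Z) 0 (rst C U Z 0 l)"
    using alg.rst_rst[OF U V(1) VZ _ V(2) l] alg.rst_rst[OF U Z(1) VZ _ Z(2) l] by simp
  then have "rst E V (V \<inter> Z) j ?a = \<zero>\<^bsub>Sec E (V \<inter> Z) j\<^esub>"
    using rst_act[OF V(1) VZ _ lV s] alg.rst_zero[OF Z(1) VZ] l'
      act_zero_left[OF VZ rst_sec[OF V(1) VZ _ s], of 0] by simp
  then obtain b where b: "b \<in> secs E U j" "rst E U V j b = ?a"
    using extend_by_zero[OF U V Z(1) _ a] Z(3) by blast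
  have "rst E U W j b = rst E V W j ?a"
    using rst_rst[OF U V(1) W(1,3) V(2) b(1)] b(2) by simp
  also have "\<dots> = rst E V W j s"
    using rst_act[OF V(1) W(1,3) lV s] alg.rst_rst[OF U V(1) W(1,3) V(2) l] l'
      act_gone[OF W(1) rst_sec[OF V(1) W(1,3) s]] by simp
  finally show ?thesis using that b(1) W by blast
qed

lemma extend_function_locally:
  assumes U: "openin X U" and V: "openin X V" "V \<subseteq> U" and x: "x \<in> V" and f: "f \<in> secs C V i"
  obtains g W where "g \<in> secs C U i" "openin X W" "x \<in> W" "W \<subseteq> V" "rst C U W i g = rst C V W i f"
proof -
  \<comment> \<open>\<open>C\<close> is a sheaf of modules over itself.\<close>
  define M :: "('x, 'a, 'a) gmod_sheaf" where "M = \<lparr>Sec = Sec C, rst = rst C, act = gmul C\<rparr>"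
  have M: "Sec M = Sec C" "rst M = rst C" "act M = gmul C" by (simp_all add: M_def)
  have "gvs_sheaf X M \<longleftrightarrow> gvs_sheaf X C" unfolding gvs_sheaf_def M ..
  then have "gvs_sheaf X M" using alg.gvs_sheaf_axioms by blast
  moreover have "gmod_sheaf_axioms X C M"
    by (rule gmod_sheaf_axioms.intro; unfold M)
      (rule alg.gmul_linear_right alg.gmul_linear_left alg.gmul_assoc alg.gone_left alg.rst_gmul; assumption)+
  ultimately interpret M: gmod_sheaf_with_cutoffs X C M
    by (intro gmod_sheaf_with_cutoffs.intro gmod_sheaf.intro gmod_sheaf_with_cutoffs_axioms.intro
        alg.galg_sheaf_axioms cutoff)
  show ?thesis
    using M.extend_section_locally[OF U V x, unfolded M, OF f] that by blast
qed

end

section \<open>Restriction and gluing of local operators\<close>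

context gmod_sheaf_with_cutoffs
begin

text \<open>
  The value at \<open>\<xi>\<close> of the restriction of \<open>F\<close> to \<open>V\<close>: near each point, \<open>\<xi>\<close> agrees with a section \<open>\<psi>\<close> over \<open>U\<close>, and the local
  sections \<open>F(\<psi>)\<close> agree on overlaps because \<open>F\<close> is local.
\<close>

lemma Loc_values_glue:
  assumes U: "openin X U" and V: "openin X V" "V \<subseteq> U" and F: "F \<in> Loc X E U d" and \<xi>: "\<xi> \<in> secs E V j"
  shows "\<exists>s\<in>secs E V (j + d). \<forall>W \<psi>. openin X W \<and> W \<subseteq> V \<and> \<psi> \<in> secs E U j \<and> rst E U W j \<psi> = rst E V W j \<xi> \<longrightarrow>
    rst E V W (j + d) s = rst E U W (j + d) (F j \<psi>)"
proof -
  define I where "I = {(W, \<psi>). openin X W \<and> W \<subseteq> V \<and> \<psi> \<in> secs E U j \<and> rst E U W j \<psi> = rst E V W j \<xi>}"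
  define \<sigma> where "\<sigma> = (\<lambda>(W, \<psi>). rst E U W (j + d) (F j \<psi>))"
  note Fsec = graded_maps_sec[OF Loc_graded[OF F]]
  have UN: "\<Union>(fst ` I) = V"
  proof
    show "V \<subseteq> \<Union>(fst ` I)"
    proof
      fix x assume "x \<in> V"
      then obtain \<psi> W where "\<psi> \<in> secs E U j" "openin X W" "x \<in> W" "W \<subseteq> V" "rst E U W j \<psi> = rst E V W j \<xi>"
        by (rule extend_section_locally[OF U V _ \<xi>])
      then have "(W, \<psi>) \<in> I" by (simp add: I_def)
      then show "x \<in> \<Union>(fst ` I)" using \<open>x \<in> W\<close> by force
    qed
  qed (auto simp: I_def)
  have "\<exists>s\<in>secs E (\<Union>(fst ` I)) (j + d). \<forall>i\<in>I. rst E (\<Union>(fst ` I)) (fst i) (j + d) s = \<sigma> i"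
  proof (rule glue_family)
    fix i assume "i \<in> I"
    then obtain W \<psi> where i: "i = (W, \<psi>)" and W: "openin X W" "W \<subseteq> V" "\<psi> \<in> secs E U j"
      by (auto simp: I_def)
    have "W \<subseteq> U" using W(2) V(2) by (rule subset_trans)
    then show "openin X (fst i)" "\<sigma> i \<in> secs E (fst i) (j + d)"
      using W(1) rst_sec[OF U W(1) _ Fsec[OF W(3)]] by (simp_all add: i \<sigma>_def)
  next
    fix i k assume "i \<in> I" "k \<in> I"
    then obtain W \<psi> W' \<psi>' where ik: "i = (W, \<psi>)" "k = (W', \<psi>')"
      and W: "openin X W" "W \<subseteq> V" "\<psi> \<in> secs E U j" "rst E U W j \<psi> = rst E V W j \<xi>"
      and W': "openin X W'" "W' \<subseteq> V" "\<psi>' \<in> secs E U j" "rst E U W' j \<psi>' = rst E V W' j \<xi>"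
      by (auto simp: I_def)
    have WW: "openin X (W \<inter> W')" and WU: "W \<subseteq> U" "W' \<subseteq> U" "W \<inter> W' \<subseteq> U" using W W' V by auto
    have "rst E U (W \<inter> W') j \<psi> = rst E V (W \<inter> W') j \<xi>"
      using rst_rst[OF U W(1) WW _ WU(1) W(3)] rst_rst[OF V(1) W(1) WW _ W(2) \<xi>] W(4) by simp
    also have "\<dots> = rst E U (W \<inter> W') j \<psi>'"
      using rst_rst[OF U W'(1) WW _ WU(2) W'(3)] rst_rst[OF V(1) W'(1) WW _ W'(2) \<xi>] W'(4) by simp
    finally have "rst E U (W \<inter> W') (j + d) (F j \<psi>) = rst E U (W \<inter> W') (j + d) (F j \<psi>')"
      by (rule Loc_eq_local[OF F U WW WU(3) W(3) W'(3)])
    then show "rst E (fst i) (fst i \<inter> fst k) (j + d) (\<sigma> i) = rst E (fst k) (fst i \<inter> fst k) (j + d) (\<sigma> k)"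
      using rst_rst[OF U W(1) WW _ WU(1) Fsec[OF W(3)]] rst_rst[OF U W'(1) WW _ WU(2) Fsec[OF W'(3)]]
      by (simp add: ik \<sigma>_def)
  qed
  then obtain s where s: "s \<in> secs E V (j + d)" "\<And>i. i \<in> I \<Longrightarrow> rst E V (fst i) (j + d) s = \<sigma> i"
    unfolding UN by blast
  then have "rst E V W (j + d) s = rst E U W (j + d) (F j \<psi>)" if "(W, \<psi>) \<in> I" for W \<psi>
    using that s(2)[OF that] by (simp add: \<sigma>_def)
  then show ?thesis using s(1) unfolding I_def by blast
qed

lemma ex_restricted_operator:
  assumes U: "openin X U" and V: "openin X V" "V \<subseteq> U" and F: "F \<in> Loc X E U d"
  shows "\<exists>G. G \<in> Loc X E V d \<and>
    (\<forall>j. \<forall>\<psi>\<in>secs E U j. rst E U V (j + d) (F j \<psi>) = G j (rst E U V j \<psi>))"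
proof -
  note Fg = Loc_graded[OF F]
  note Fsec = graded_maps_sec[OF Fg]
  define P where "P j \<xi> s \<longleftrightarrow> s \<in> secs E V (j + d) \<and> (\<forall>W \<psi>. openin X W \<longrightarrow> W \<subseteq> V \<longrightarrow> \<psi> \<in> secs E U j \<longrightarrow>
    rst E U W j \<psi> = rst E V W j \<xi> \<longrightarrow> rst E V W (j + d) s = rst E U W (j + d) (F j \<psi>))" for j \<xi> s
  define G where "G j = (\<lambda>\<xi>\<in>secs E V j. SOME s. P j \<xi> s)" for j
  have GP: "P j \<xi> (G j \<xi>)" if "\<xi> \<in> secs E V j" for j \<xi>
    using someI_ex[of "P j \<xi>"] Loc_values_glue[OF U V F that] that by (auto simp: G_def P_def)
  then have Gsec: "G j \<xi> \<in> secs E V (j + d)" if "\<xi> \<in> secs E V j" for j \<xi>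
    using that by (simp add: P_def)
  have Gval: "rst E V W (j + d) (G j \<xi>) = rst E U W (j + d) (F j \<psi>)"
    if "\<xi> \<in> secs E V j" "openin X W" "W \<subseteq> V" "\<psi> \<in> secs E U j" "rst E U W j \<psi> = rst E V W j \<xi>" for j \<xi> W \<psi>
    using GP[OF that(1)] that(2-) by (simp add: P_def)
  \<comment> \<open>Two sections over \<open>V\<close> can be extended on a common neighbourhood, by taking for \<open>N\<close> the one that serves for the first.\<close>
  have ext: "\<exists>\<psi> W. \<psi> \<in> secs E U j \<and> openin X W \<and> x \<in> W \<and> W \<subseteq> V \<and> W \<subseteq> N \<and> W \<subseteq> U \<and> rst E U W j \<psi> = rst E V W j \<xi>"
    if \<xi>: "\<xi> \<in> secs E V j" and N: "openin X N" "x \<in> N" and x: "x \<in> V" for j \<xi> x N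
  proof -
    obtain \<psi> W where W: "\<psi> \<in> secs E U j" "openin X W" "x \<in> W" "W \<subseteq> V" "rst E U W j \<psi> = rst E V W j \<xi>"
      by (rule extend_section_locally[OF U V x \<xi>])
    have WN: "openin X (W \<inter> N)" and WU: "W \<subseteq> U" using W N V by auto
    have "rst E U (W \<inter> N) j \<psi> = rst E V (W \<inter> N) j \<xi>"
      using rst_rst[OF U W(2) WN _ WU W(1)] rst_rst[OF V(1) W(2) WN _ W(4) \<xi>] W(5) by simp
    then show ?thesis using W(1,3,4) WN WU N(2) by (intro exI[of _ \<psi>] exI[of _ "W \<inter> N"]) auto
  qed
  have "G \<in> graded_maps E V d"
  proof (rule graded_mapsI)
    show "G j s = undefined" if "s \<notin> secs E V j" for j s using that by (simp add: G_def)
    show "G j s \<in> secs E V (j + d)" if "s \<in> secs E V j" for j s by (rule Gsec[OF that])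
  next
    fix j s t assume s: "s \<in> secs E V j" and t: "t \<in> secs E V j"
    have st: "s \<oplus>\<^bsub>Sec E V j\<^esub> t \<in> secs E V j" by (rule add_sec[OF V(1) s t])
    show "G j (s \<oplus>\<^bsub>Sec E V j\<^esub> t) = G j s \<oplus>\<^bsub>Sec E V (j + d)\<^esub> G j t"
    proof (rule sec_eqI_local[OF V(1) Gsec[OF st] add_sec[OF V(1) Gsec[OF s] Gsec[OF t]]])
      fix x assume x: "x \<in> V"
      obtain \<psi> N where N: "\<psi> \<in> secs E U j" "openin X N" "x \<in> N" "N \<subseteq> V" "N \<subseteq> U" "rst E U N j \<psi> = rst E V N j s"
        using ext[OF s V(1) x x] by blast
      obtain \<psi>' W where W: "\<psi>' \<in> secs E U j" "openin X W" "x \<in> W" "W \<subseteq> V" "W \<subseteq> N" "W \<subseteq> U"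
        "rst E U W j \<psi>' = rst E V W j t"
        using ext[OF t N(2,3) x] by blast
      have \<psi>: "rst E U W j \<psi> = rst E V W j s"
        using rst_rst[OF U N(2) W(2,5) N(5,1)] rst_rst[OF V(1) N(2) W(2,5) N(4) s] N(6) by simp
      have "rst E V W (j + d) (G j (s \<oplus>\<^bsub>Sec E V j\<^esub> t)) = rst E U W (j + d) (F j (\<psi> \<oplus>\<^bsub>Sec E U j\<^esub> \<psi>'))"
        using W(7) \<psi>
        by (intro Gval st W add_sec U N(1)) (simp add: rst_add[OF U W(2,6) N(1) W(1)] rst_add[OF V(1) W(2,4) s t])
      also have "\<dots> = rst E U W (j + d) (F j \<psi>) \<oplus>\<^bsub>Sec E W (j + d)\<^esub> rst E U W (j + d) (F j \<psi>')"
        by (simp add: graded_maps_add[OF Fg N(1) W(1)] rst_add[OF U W(2,6) Fsec[OF N(1)] Fsec[OF W(1)]])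
      also have "\<dots> = rst E V W (j + d) (G j s \<oplus>\<^bsub>Sec E V (j + d)\<^esub> G j t)"
        by (simp add: rst_add[OF V(1) W(2,4) Gsec[OF s] Gsec[OF t]] Gval[OF s W(2,4) N(1) \<psi>] Gval[OF t W(2,4,1,7)])
      finally show "\<exists>W. openin X W \<and> x \<in> W \<and> W \<subseteq> V \<and>
          rst E V W (j + d) (G j (s \<oplus>\<^bsub>Sec E V j\<^esub> t)) = rst E V W (j + d) (G j s \<oplus>\<^bsub>Sec E V (j + d)\<^esub> G j t)"
        using W by blast
    qed
  next
    fix j c s assume s: "s \<in> secs E V j"
    have cs: "c \<odot>\<^bsub>Sec E V j\<^esub> s \<in> secs E V j" by (rule smult_sec[OF V(1) s])
    show "G j (c \<odot>\<^bsub>Sec E V j\<^esub> s) = c \<odot>\<^bsub>Sec E V (j + d)\<^esub> G j s"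
    proof (rule sec_eqI_local[OF V(1) Gsec[OF cs] smult_sec[OF V(1) Gsec[OF s]]])
      fix x assume x: "x \<in> V"
      obtain \<psi> W where W: "\<psi> \<in> secs E U j" "openin X W" "x \<in> W" "W \<subseteq> V" "W \<subseteq> U" "rst E U W j \<psi> = rst E V W j s"
        using ext[OF s V(1) x x] by blast
      have "rst E V W (j + d) (G j (c \<odot>\<^bsub>Sec E V j\<^esub> s)) = rst E U W (j + d) (F j (c \<odot>\<^bsub>Sec E U j\<^esub> \<psi>))"
        using W(6) by (intro Gval cs W smult_sec U) (simp add: rst_smult[OF U W(2,5,1)] rst_smult[OF V(1) W(2,4) s])
      also have "\<dots> = rst E V W (j + d) (c \<odot>\<^bsub>Sec E V (j + d)\<^esub> G j s)"
        by (simp add: graded_maps_smult[OF Fg W(1)] rst_smult[OF U W(2,5) Fsec[OF W(1)]]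
            rst_smult[OF V(1) W(2,4) Gsec[OF s]] Gval[OF s W(2,4,1,6)])
      finally show "\<exists>W. openin X W \<and> x \<in> W \<and> W \<subseteq> V \<and>
          rst E V W (j + d) (G j (c \<odot>\<^bsub>Sec E V j\<^esub> s)) = rst E V W (j + d) (c \<odot>\<^bsub>Sec E V (j + d)\<^esub> G j s)"
        using W by blast
    qed
  qed
  moreover have "rst E V W (j + d) (G j s) = \<zero>\<^bsub>Sec E W (j + d)\<^esub>"
    if W: "openin X W" "W \<subseteq> V" and s: "s \<in> secs E V j" "rst E V W j s = \<zero>\<^bsub>Sec E W j\<^esub>" for W j s
  proof -
    have WU: "W \<subseteq> U" using W V by blast
    have "rst E U W j \<zero>\<^bsub>Sec E U j\<^esub> = rst E V W j s" using s rst_zero[OF U W(1) WU] by simp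
    then have "rst E V W (j + d) (G j s) = rst E U W (j + d) (F j \<zero>\<^bsub>Sec E U j\<^esub>)"
      by (intro Gval s W zero_sec U)
    then show ?thesis by (simp add: graded_maps_zero[OF U Fg] rst_zero[OF U W(1) WU])
  qed
  ultimately have "G \<in> Loc X E V d" by (rule LocI)
  moreover have "rst E U V (j + d) (F j \<psi>) = G j (rst E U V j \<psi>)" if \<psi>: "\<psi> \<in> secs E U j" for j \<psi>
  proof -
    note V\<psi> = rst_sec[OF U V \<psi>]
    show ?thesis
      using Gval[OF V\<psi> V(1) subset_refl \<psi>] rst_id[OF V(1) V\<psi>] rst_id[OF V(1) Gsec[OF V\<psi>]] by simp
  qed
  ultimately show ?thesis by blast
qed

lemma restricted_operator_unique:
  assumes U: "openin X U" and V: "openin X V" "V \<subseteq> U"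
    and G: "G \<in> Loc X E V d" "G' \<in> Loc X E V d"
    and eq: "\<And>j \<psi>. \<psi> \<in> secs E U j \<Longrightarrow> G j (rst E U V j \<psi>) = G' j (rst E U V j \<psi>)"
  shows "G = G'"
proof (rule graded_maps_eqI[OF G[THEN Loc_graded]])
  fix j s assume s: "s \<in> secs E V j"
  note sec = graded_maps_sec[OF Loc_graded[OF G(1)] s] graded_maps_sec[OF Loc_graded[OF G(2)] s]
  show "G j s = G' j s"
  proof (rule sec_eqI_local[OF V(1) sec])
    fix x assume "x \<in> V"
    then obtain \<psi> W where W: "\<psi> \<in> secs E U j" "openin X W" "x \<in> W" "W \<subseteq> V" "rst E U W j \<psi> = rst E V W j s"
      by (rule extend_section_locally[OF U V _ s])
    note V\<psi> = rst_sec[OF U V W(1)]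
    have "rst E V W j s = rst E V W j (rst E U V j \<psi>)"
      using rst_rst[OF U V(1) W(2,4) V(2) W(1)] W(5) by simp
    then have "rst E V W (j + d) (G j s) = rst E V W (j + d) (G' j s)"
      using Loc_eq_local[OF G(1) V(1) W(2,4) s V\<psi>] Loc_eq_local[OF G(2) V(1) W(2,4) s V\<psi>] eq[OF W(1)] by simp
    then show "\<exists>W. openin X W \<and> x \<in> W \<and> W \<subseteq> V \<and> rst E V W (j + d) (G j s) = rst E V W (j + d) (G' j s)"
      using W by blast
  qed
qed

context
  fixes U V F d
  assumes U: "openin X U" and V: "openin X V" "V \<subseteq> U" and F: "F \<in> Loc X E U d"
begin

lemma op_rst_unique:
  assumes "G \<in> Loc X E V d"
    and "\<And>j \<psi>. \<psi> \<in> secs E U j \<Longrightarrow> rst E U V (j + d) (F j \<psi>) = G j (rst E U V j \<psi>)"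
  shows "op_rst X E U V d F = G"
  unfolding op_rst_def
proof (rule the_equality)
  show "G \<in> Loc X E V d \<and> (\<forall>j. \<forall>\<psi>\<in>secs E U j. rst E U V (j + d) (F j \<psi>) = G j (rst E U V j \<psi>))"
    using assms by blast
  show "G' = G" if "G' \<in> Loc X E V d \<and> (\<forall>j. \<forall>\<psi>\<in>secs E U j. rst E U V (j + d) (F j \<psi>) = G' j (rst E U V j \<psi>))" for G'
    using that assms by (intro restricted_operator_unique[OF U V]) auto
qed

lemma op_rst_Loc: "op_rst X E U V d F \<in> Loc X E V d"
  and op_rst_apply: "\<psi> \<in> secs E U j \<Longrightarrow> op_rst X E U V d F j (rst E U V j \<psi>) = rst E U V (j + d) (F j \<psi>)"
proof -
  obtain G where "G \<in> Loc X E V d" "\<And>j \<psi>. \<psi> \<in> secs E U j \<Longrightarrow> rst E U V (j + d) (F j \<psi>) = G j (rst E U V j \<psi>)"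
    using ex_restricted_operator[OF U V F] by blast
  moreover from this have "op_rst X E U V d F = G" by (rule op_rst_unique)
  ultimately show "op_rst X E U V d F \<in> Loc X E V d"
    "\<psi> \<in> secs E U j \<Longrightarrow> op_rst X E U V d F j (rst E U V j \<psi>) = rst E U V (j + d) (F j \<psi>)"
    by simp_all
qed

end

lemma op_rst_id: "\<lbrakk>openin X U; F \<in> Loc X E U d\<rbrakk> \<Longrightarrow> op_rst X E U U d F = F"
  by (rule op_rst_unique) (auto simp: rst_id graded_maps_sec[OF Loc_graded])

lemma op_rst_trans:
  assumes U: "openin X U" and V: "openin X V" "V \<subseteq> U" and W: "openin X W" "W \<subseteq> V" and F: "F \<in> Loc X E U d"
  shows "op_rst X E V W d (op_rst X E U V d F) = op_rst X E U W d F"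
proof (rule sym, rule op_rst_unique[OF U W(1) _ F])
  show WU: "W \<subseteq> U" using V W by blast
  note FV = op_rst_Loc[OF U V F]
  show "op_rst X E V W d (op_rst X E U V d F) \<in> Loc X E W d"
    by (rule op_rst_Loc[OF V(1) W FV])
  show "rst E U W (j + d) (F j \<psi>) = op_rst X E V W d (op_rst X E U V d F) j (rst E U W j \<psi>)"
    if \<psi>: "\<psi> \<in> secs E U j" for j \<psi>
    using op_rst_apply[OF V(1) W FV rst_sec[OF U V \<psi>]] op_rst_apply[OF U V F \<psi>]
      rst_rst[OF U V(1) W V(2) \<psi>] rst_rst[OF U V(1) W V(2) graded_maps_sec[OF Loc_graded[OF F] \<psi>]]
    by simp
qed

lemma op_rst_add:
  assumes U: "openin X U" and V: "openin X V" "V \<subseteq> U" and F: "F \<in> Loc X E U d" and G: "G \<in> Loc X E U d"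
  shows "op_rst X E U V d (op_add E U d F G) = op_add E V d (op_rst X E U V d F) (op_rst X E U V d G)"
  by (rule op_rst_unique[OF U V op_add_Loc[OF U F G] op_add_Loc[OF V(1) op_rst_Loc[OF U V F] op_rst_Loc[OF U V G]]])
    (simp add: rst_sec[OF U V] op_rst_apply[OF U V F] op_rst_apply[OF U V G] rst_add[OF U V]
      graded_maps_sec[OF Loc_graded[OF F]] graded_maps_sec[OF Loc_graded[OF G]])

lemma op_rst_smult:
  assumes U: "openin X U" and V: "openin X V" "V \<subseteq> U" and F: "F \<in> Loc X E U d"
  shows "op_rst X E U V d (op_smult E U d c F) = op_smult E V d c (op_rst X E U V d F)"
  by (rule op_rst_unique[OF U V op_smult_Loc[OF U F] op_smult_Loc[OF V(1) op_rst_Loc[OF U V F]]])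
    (simp add: rst_sec[OF U V] op_rst_apply[OF U V F] rst_smult[OF U V] graded_maps_sec[OF Loc_graded[OF F]])

lemma op_rst_act:
  assumes U: "openin X U" and V: "openin X V" "V \<subseteq> U" and F: "F \<in> Loc X E U d" and f: "f \<in> secs C U i"
  shows "op_rst X E U V (i + d) (op_act E U i d f F) = op_act E V i d (rst C U V i f) (op_rst X E U V d F)"
proof (rule op_rst_unique[OF U V op_act_Loc[OF U F f] op_act_Loc[OF V(1) op_rst_Loc[OF U V F] alg.rst_sec[OF U V f]]])
  fix j \<psi> assume \<psi>: "\<psi> \<in> secs E U j"
  show "rst E U V (j + (i + d)) (op_act E U i d f F j \<psi>)
      = op_act E V i d (rst C U V i f) (op_rst X E U V d F) j (rst E U V j \<psi>)"
    using rst_act[OF U V f graded_maps_sec[OF Loc_graded[OF F] \<psi>]] \<psi>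
    by (simp add: rst_sec[OF U V] op_rst_apply[OF U V F] add.left_commute)
qed

lemma Loc_separated:
  assumes \<V>: "\<forall>V\<in>\<V>. openin X V" and F: "F \<in> Loc X E (\<Union>\<V>) d" and G: "G \<in> Loc X E (\<Union>\<V>) d"
    and eq: "\<forall>V\<in>\<V>. op_rst X E (\<Union>\<V>) V d F = op_rst X E (\<Union>\<V>) V d G"
  shows "F = G"
proof (rule graded_maps_eqI[OF Loc_graded[OF F] Loc_graded[OF G]])
  have U: "openin X (\<Union>\<V>)" using \<V> by (simp add: openin_Union)
  fix j s assume s: "s \<in> secs E (\<Union>\<V>) j"
  have "rst E (\<Union>\<V>) V (j + d) (F j s) = rst E (\<Union>\<V>) V (j + d) (G j s)" if V: "V \<in> \<V>" for V
  proof -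
    have V': "openin X V" "V \<subseteq> \<Union>\<V>" using V \<V> by auto
    show ?thesis using op_rst_apply[OF U V' F s] op_rst_apply[OF U V' G s] eq V by simp
  qed
  then show "F j s = G j s"
    using separated[OF \<V> graded_maps_sec[OF Loc_graded[OF F] s] graded_maps_sec[OF Loc_graded[OF G] s]] by blast
qed

lemma Loc_gluing:
  assumes \<V>: "\<forall>V\<in>\<V>. openin X V" and H: "\<forall>V\<in>\<V>. H V \<in> Loc X E V d"
    and agree: "\<forall>V\<in>\<V>. \<forall>W\<in>\<V>. op_rst X E V (V \<inter> W) d (H V) = op_rst X E W (V \<inter> W) d (H W)"
  shows "\<exists>F\<in>Loc X E (\<Union>\<V>) d. \<forall>V\<in>\<V>. op_rst X E (\<Union>\<V>) V d F = H V"
proof -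
  let ?U = "\<Union>\<V>"
  have U: "openin X ?U" using \<V> by (simp add: openin_Union)
  have V: "openin X V" "V \<subseteq> ?U" "H V \<in> Loc X E V d" "H V \<in> graded_maps E V d" if "V \<in> \<V>" for V
    using \<V> H Loc_graded that by auto
  have Hsec: "H V j (rst E ?U V j s) \<in> secs E V (j + d)" if "V \<in> \<V>" "s \<in> secs E ?U j" for V j s
    by (rule graded_maps_sec[OF V(4)[OF that(1)] rst_sec[OF U V(1,2)[OF that(1)] that(2)]])
  have ex: "\<exists>t\<in>secs E ?U (j + d). \<forall>V\<in>\<V>. rst E ?U V (j + d) t = H V j (rst E ?U V j s)"
    if s: "s \<in> secs E ?U j" for j s
  proof (rule gluing[OF \<V>]; intro ballI)
    show "H V j (rst E ?U V j s) \<in> secs E V (j + d)" if "V \<in> \<V>" for V by (rule Hsec[OF that s])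
    fix V W assume VW: "V \<in> \<V>" "W \<in> \<V>"
    note V1 = V[OF VW(1)] and W1 = V[OF VW(2)]
    have O: "openin X (V \<inter> W)" "V \<inter> W \<subseteq> V" "V \<inter> W \<subseteq> W" using V1 W1 by auto
    show "rst E V (V \<inter> W) (j + d) (H V j (rst E ?U V j s)) = rst E W (V \<inter> W) (j + d) (H W j (rst E ?U W j s))"
      using op_rst_apply[OF V1(1) O(1,2) V1(3) rst_sec[OF U V1(1,2) s]]
        op_rst_apply[OF W1(1) O(1,3) W1(3) rst_sec[OF U W1(1,2) s]]
        rst_rst[OF U V1(1) O(1,2) V1(2) s] rst_rst[OF U W1(1) O(1,3) W1(2) s] agree VW by metis
  qed
  define F where "F j = (\<lambda>s\<in>secs E ?U j. SOME t. t \<in> secs E ?U (j + d) \<and>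
    (\<forall>V\<in>\<V>. rst E ?U V (j + d) t = H V j (rst E ?U V j s)))" for j
  have F_glued: "F j s \<in> secs E ?U (j + d) \<and> (\<forall>V\<in>\<V>. rst E ?U V (j + d) (F j s) = H V j (rst E ?U V j s))"
    if s: "s \<in> secs E ?U j" for j s
  proof -
    have "\<exists>t. t \<in> secs E ?U (j + d) \<and> (\<forall>V\<in>\<V>. rst E ?U V (j + d) t = H V j (rst E ?U V j s))"
      using ex[OF s] by blast
    from someI_ex[OF this] show ?thesis using s by (simp add: F_def)
  qed
  have Fsec: "F j s \<in> secs E ?U (j + d)" if "s \<in> secs E ?U j" for j s
    using F_glued[OF that] by blast
  have Fval: "rst E ?U V (j + d) (F j s) = H V j (rst E ?U V j s)" if "s \<in> secs E ?U j" "V \<in> \<V>" for j s V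
    using F_glued[OF that(1)] that(2) by blast
  have F_loc: "F \<in> Loc X E ?U d"
  proof (rule LocI, rule graded_mapsI)
    show "F j s = undefined" if "s \<notin> secs E ?U j" for j s using that by (simp add: F_def)
    show "F j s \<in> secs E ?U (j + d)" if "s \<in> secs E ?U j" for j s by (rule Fsec[OF that])
  next
    fix j s t assume s: "s \<in> secs E ?U j" and t: "t \<in> secs E ?U j"
    show "F j (s \<oplus>\<^bsub>Sec E ?U j\<^esub> t) = F j s \<oplus>\<^bsub>Sec E ?U (j + d)\<^esub> F j t"
    proof (rule separated[OF \<V> Fsec[OF add_sec[OF U s t]] add_sec[OF U Fsec[OF s] Fsec[OF t]]], intro ballI)
      fix V assume VV: "V \<in> \<V>"
      note V1 = V[OF VV]
      show "rst E ?U V (j + d) (F j (s \<oplus>\<^bsub>Sec E ?U j\<^esub> t)) = rst E ?U V (j + d) (F j s \<oplus>\<^bsub>Sec E ?U (j + d)\<^esub> F j t)"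
        using s t
        by (simp add: Fval[OF _ VV] add_sec[OF U] rst_add[OF U V1(1,2)] Fsec graded_maps_add[OF V1(4)] rst_sec[OF U V1(1,2)])
    qed
  next
    fix j c s assume s: "s \<in> secs E ?U j"
    show "F j (c \<odot>\<^bsub>Sec E ?U j\<^esub> s) = c \<odot>\<^bsub>Sec E ?U (j + d)\<^esub> F j s"
    proof (rule separated[OF \<V> Fsec[OF smult_sec[OF U s]] smult_sec[OF U Fsec[OF s]]], intro ballI)
      fix V assume VV: "V \<in> \<V>"
      note V1 = V[OF VV]
      show "rst E ?U V (j + d) (F j (c \<odot>\<^bsub>Sec E ?U j\<^esub> s)) = rst E ?U V (j + d) (c \<odot>\<^bsub>Sec E ?U (j + d)\<^esub> F j s)"
        using s
        by (simp add: Fval[OF _ VV] smult_sec[OF U] rst_smult[OF U V1(1,2)] Fsec graded_maps_smult[OF V1(4)] rst_sec[OF U V1(1,2)])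
    qed
  next
    fix W j s assume W: "openin X W" "W \<subseteq> ?U" and s: "s \<in> secs E ?U j" "rst E ?U W j s = \<zero>\<^bsub>Sec E W j\<^esub>"
    show "rst E ?U W (j + d) (F j s) = \<zero>\<^bsub>Sec E W (j + d)\<^esub>"
    proof (rule sec_eqI_local[OF W(1) rst_sec[OF U W Fsec[OF s(1)]] zero_sec[OF W(1)]])
      fix x assume x: "x \<in> W"
      then obtain V where VV: "V \<in> \<V>" "x \<in> V" using W by blast
      note V1 = V[OF VV(1)]
      have O: "openin X (W \<inter> V)" "W \<inter> V \<subseteq> W" "W \<inter> V \<subseteq> V" using V1 W by auto
      have "rst E V (W \<inter> V) j (rst E ?U V j s) = \<zero>\<^bsub>Sec E (W \<inter> V) j\<^esub>"
        using rst_rst[OF U V1(1) O(1,3) V1(2) s(1)] rst_rst[OF U W(1) O(1,2) W(2) s(1)] s(2) rst_zero[OF W(1) O(1,2)]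
        by simp
      then have "rst E V (W \<inter> V) (j + d) (rst E ?U V (j + d) (F j s)) = \<zero>\<^bsub>Sec E (W \<inter> V) (j + d)\<^esub>"
        using Loc_vanish[OF V1(3) O(1,3) rst_sec[OF U V1(1,2) s(1)]] Fval[OF s(1) VV(1)] by simp
      then have "rst E W (W \<inter> V) (j + d) (rst E ?U W (j + d) (F j s)) = rst E W (W \<inter> V) (j + d) \<zero>\<^bsub>Sec E W (j + d)\<^esub>"
        using rst_rst[OF U V1(1) O(1,3) V1(2) Fsec[OF s(1)]] rst_rst[OF U W(1) O(1,2) W(2) Fsec[OF s(1)]]
          rst_zero[OF W(1) O(1,2)] by simp
      then show "\<exists>N. openin X N \<and> x \<in> N \<and> N \<subseteq> W \<and>
          rst E W N (j + d) (rst E ?U W (j + d) (F j s)) = rst E W N (j + d) \<zero>\<^bsub>Sec E W (j + d)\<^esub>"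
        using O x VV by (intro exI[of _ "W \<inter> V"]) auto
    qed
  qed
  moreover have "op_rst X E ?U V d F = H V" if "V \<in> \<V>" for V
    by (rule op_rst_unique[OF U V(1,2)[OF that] F_loc V(3)[OF that] Fval[OF _ that]])
  ultimately show ?thesis by blast
qed

end

section \<open>Subsheaves of the sheaf of local operators\<close>

text \<open>
  A family of sets of local operators that is closed under the module operations and restriction
  and to which an operator belongs as soon as its restrictions to the members of an open cover do.
\<close>

locale local_operator_subsheaf = gmod_sheaf_with_cutoffs X C E
  for X :: "'x topology" and C :: "('x, 'a, 'm) galg_sheaf_scheme"
    and E :: "('x, 'a, 's, 'l) gmod_sheaf_scheme" +
  fixes H :: "'x set \<Rightarrow> int \<Rightarrow> (int \<Rightarrow> 's \<Rightarrow> 's) set"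
  assumes H_Loc: "openin X U \<Longrightarrow> H U d \<subseteq> Loc X E U d"
    and H_zero: "openin X U \<Longrightarrow> op_zero E U d \<in> H U d"
    and H_add: "\<lbrakk>openin X U; F \<in> H U d; G \<in> H U d\<rbrakk> \<Longrightarrow> op_add E U d F G \<in> H U d"
    and H_smult: "\<lbrakk>openin X U; F \<in> H U d\<rbrakk> \<Longrightarrow> op_smult E U d c F \<in> H U d"
    and H_act: "\<lbrakk>openin X U; f \<in> secs C U i; F \<in> H U d\<rbrakk> \<Longrightarrow> op_act E U i d f F \<in> H U (i + d)"
    and H_rst: "\<lbrakk>openin X U; openin X V; V \<subseteq> U; F \<in> H U d\<rbrakk> \<Longrightarrow> op_rst X E U V d F \<in> H V d"
    and H_local: "\<lbrakk>\<forall>V\<in>\<V>. openin X V; F \<in> Loc X E (\<Union>\<V>) d;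
        \<forall>V\<in>\<V>. op_rst X E (\<Union>\<V>) V d F \<in> H V d\<rbrakk> \<Longrightarrow> F \<in> H (\<Union>\<V>) d"
begin

lemma H_LocD: "\<lbrakk>openin X U; F \<in> H U d\<rbrakk> \<Longrightarrow> F \<in> Loc X E U d"
  using H_Loc by blast

lemma H_graded: "\<lbrakk>openin X U; F \<in> H U d\<rbrakk> \<Longrightarrow> F \<in> graded_maps E U d"
  using H_LocD Loc_graded by blast

lemma H_eqI:
  assumes "openin X U" "F \<in> H U d" "G \<in> H U d" "\<And>j s. s \<in> secs E U j \<Longrightarrow> F j s = G j s"
  shows "F = G"
  using assms H_graded by (intro graded_maps_eqI)

lemma op_module:
  assumes U: "openin X U"
  shows "module real_ring (Sec (op_sheaf X E H) U d)"
proof (rule moduleI[OF cring_real_ring])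
  note sec = graded_maps_sec[OF H_graded[OF U]]
  note closed = H_zero[OF U] H_add[OF U] H_smult[OF U]
  show "abelian_group (Sec (op_sheaf X E H) U d)"
  proof (rule abelian_groupI; unfold op_sheaf_fields)
    fix F G assume F: "F \<in> H U d" and G: "G \<in> H U d"
    show "op_add E U d F G \<in> H U d" by (rule closed(2)[OF F G])
    show "op_add E U d F G = op_add E U d G F"
      by (rule H_eqI[OF U, where d = d]) (simp_all add: closed F G sec[OF F] sec[OF G] sec_comm[OF U])
    show "op_add E U d (op_add E U d F G) K = op_add E U d F (op_add E U d G K)" if K: "K \<in> H U d" for K
      by (rule H_eqI[OF U, where d = d]) (simp_all add: closed F G K sec[OF F] sec[OF G] sec[OF K] sec_assoc[OF U])
  next
    fix F assume F: "F \<in> H U d"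
    show "op_add E U d (op_zero E U d) F = F"
      by (rule H_eqI[OF U, where d = d]) (simp_all add: closed F sec[OF F] sec_zero_left[OF U])
    have "op_add E U d (op_smult E U d (- 1) F) F = op_zero E U d"
      by (rule H_eqI[OF U, where d = d])
        (simp_all add: closed F sec[OF F] sec_comm[OF U smult_sec[OF U sec[OF F]] sec[OF F]] diff_eq_zero_iff[OF U])
    then show "\<exists>G\<in>H U d. op_add E U d G F = op_zero E U d" using closed(3)[OF F] by blast
  qed (rule closed)
  fix a b :: real and F G
  assume "F \<in> secs (op_sheaf X E H) U d"
  then have F: "F \<in> H U d" by simp
  show "a \<odot>\<^bsub>Sec (op_sheaf X E H) U d\<^esub> F \<in> secs (op_sheaf X E H) U d" using closed F by simp
  show "(a \<oplus>\<^bsub>real_ring\<^esub> b) \<odot>\<^bsub>Sec (op_sheaf X E H) U d\<^esub> F =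
      a \<odot>\<^bsub>Sec (op_sheaf X E H) U d\<^esub> F \<oplus>\<^bsub>Sec (op_sheaf X E H) U d\<^esub> b \<odot>\<^bsub>Sec (op_sheaf X E H) U d\<^esub> F"
    unfolding op_sheaf_fields real_ring_def ring.simps
    by (rule H_eqI[OF U, where d = d]) (simp_all add: closed F sec[OF F] smult_add_left[OF U])
  show "(a \<otimes>\<^bsub>real_ring\<^esub> b) \<odot>\<^bsub>Sec (op_sheaf X E H) U d\<^esub> F =
      a \<odot>\<^bsub>Sec (op_sheaf X E H) U d\<^esub> (b \<odot>\<^bsub>Sec (op_sheaf X E H) U d\<^esub> F)"
    unfolding op_sheaf_fields real_ring_def monoid.simps
    by (rule H_eqI[OF U, where d = d]) (simp_all add: closed F sec[OF F] smult_smult[OF U])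
  show "\<one>\<^bsub>real_ring\<^esub> \<odot>\<^bsub>Sec (op_sheaf X E H) U d\<^esub> F = F"
    unfolding op_sheaf_fields real_ring_def monoid.simps
    by (rule H_eqI[OF U, where d = d]) (simp_all add: closed F sec[OF F] smult_one[OF U])
  assume "G \<in> secs (op_sheaf X E H) U d"
  then have G: "G \<in> H U d" by simp
  show "a \<odot>\<^bsub>Sec (op_sheaf X E H) U d\<^esub> (F \<oplus>\<^bsub>Sec (op_sheaf X E H) U d\<^esub> G) =
      a \<odot>\<^bsub>Sec (op_sheaf X E H) U d\<^esub> F \<oplus>\<^bsub>Sec (op_sheaf X E H) U d\<^esub> a \<odot>\<^bsub>Sec (op_sheaf X E H) U d\<^esub> G"
    unfolding op_sheaf_fields
    by (rule H_eqI[OF U, where d = d]) (simp_all add: closed F G sec[OF F] sec[OF G] smult_add_right[OF U])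
qed

lemma op_gvs_sheaf: "gvs_sheaf X (op_sheaf X E H)"
proof (rule gvs_sheaf.intro, goal_cases)
  case (1 U d)
  then show ?case by (rule op_module)
next
  case (2 U V d)
  then show ?case
    by (simp add: rlinear_def H_rst H_LocD op_rst_add op_rst_smult)
next
  case (3 U F d)
  then show ?case by (simp add: op_rst_id H_LocD)
next
  case (4 U V W F d)
  then show ?case by (simp add: op_rst_trans H_LocD)
next
  case (5 \<V> F d G)
  then have "openin X (\<Union>\<V>)" by (simp add: openin_Union)
  then show ?case using 5 H_LocD by (intro Loc_separated[of \<V> F d G]) auto
next
  case (6 \<V> \<sigma> d)
  then have "\<exists>F\<in>Loc X E (\<Union>\<V>) d. \<forall>V\<in>\<V>. op_rst X E (\<Union>\<V>) V d F = \<sigma> V"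
    by (intro Loc_gluing) (auto simp: H_LocD)
  then obtain F where F: "F \<in> Loc X E (\<Union>\<V>) d" "\<forall>V\<in>\<V>. op_rst X E (\<Union>\<V>) V d F = \<sigma> V" by blast
  moreover from this have "F \<in> H (\<Union>\<V>) d" using 6 by (intro H_local) auto
  ultimately show ?case by auto
qed

lemma op_gmod_sheaf: "gmod_sheaf X C (op_sheaf X E H)"
proof (intro gmod_sheaf.intro gmod_sheaf_axioms.intro alg.galg_sheaf_axioms op_gvs_sheaf)
  note secE = graded_maps_sec[OF H_graded]
  fix U assume U: "openin X U"
  show "rlinear (Sec (op_sheaf X E H) U d) (Sec (op_sheaf X E H) U (i + d)) (act (op_sheaf X E H) U i d f)"
    if f: "f \<in> secs C U i" for i d f
    unfolding rlinear_def op_sheaf_fields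
  proof (intro conjI allI ballI)
    show "op_act E U i d f \<in> H U d \<rightarrow> H U (i + d)" using H_act[OF U f] by blast
    fix F assume F: "F \<in> H U d"
    show "op_act E U i d f (op_smult E U d c F) = op_smult E U (i + d) c (op_act E U i d f F)" for c
      by (rule H_eqI[OF U H_act[OF U f H_smult[OF U F]] H_smult[OF U H_act[OF U f F]]])
        (simp add: act_smult_right[OF U f secE[OF U F]] add.left_commute)
    show "op_act E U i d f (op_add E U d F G) = op_add E U (i + d) (op_act E U i d f F) (op_act E U i d f G)"
      if G: "G \<in> H U d" for G
      by (rule H_eqI[OF U H_act[OF U f H_add[OF U F G]] H_add[OF U H_act[OF U f F] H_act[OF U f G]]])
        (simp add: act_add_right[OF U f secE[OF U F] secE[OF U G]] add.left_commute)
  qed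
  show "rlinear (Sec C U i) (Sec (op_sheaf X E H) U (i + d)) (\<lambda>f. act (op_sheaf X E H) U i d f F)"
    if "F \<in> secs (op_sheaf X E H) U d" for i d F
    unfolding rlinear_def op_sheaf_fields
  proof (intro conjI allI ballI)
    have F: "F \<in> H U d" using that by simp
    show "(\<lambda>f. op_act E U i d f F) \<in> secs C U i \<rightarrow> H U (i + d)" using H_act[OF U _ F] by blast
    fix f assume f: "f \<in> secs C U i"
    show "op_act E U i d (c \<odot>\<^bsub>Sec C U i\<^esub> f) F = op_smult E U (i + d) c (op_act E U i d f F)" for c
      by (rule H_eqI[OF U H_act[OF U alg.smult_sec[OF U f] F] H_smult[OF U H_act[OF U f F]]])
        (simp add: act_smult_left[OF U f secE[OF U F]] add.left_commute)
    show "op_act E U i d (f \<oplus>\<^bsub>Sec C U i\<^esub> g) F = op_add E U (i + d) (op_act E U i d f F) (op_act E U i d g F)"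
      if g: "g \<in> secs C U i" for g
      by (rule H_eqI[OF U H_act[OF U alg.add_sec[OF U f g] F] H_add[OF U H_act[OF U f F] H_act[OF U g F]]])
        (simp add: act_add_left[OF U f g secE[OF U F]] add.left_commute)
  qed
  show "act (op_sheaf X E H) U (i + j) d (gmul C U i j f g) F =
      act (op_sheaf X E H) U i (j + d) f (act (op_sheaf X E H) U j d g F)"
    if f: "f \<in> secs C U i" and g: "g \<in> secs C U j" and "F \<in> secs (op_sheaf X E H) U d" for i j d f g F
    unfolding op_sheaf_fields
  proof -
    have F: "F \<in> H U d" using that by simp
    have fg: "gmul C U i j f g \<in> secs C U (i + j)"
      by (rule rlinearD(1)[OF alg.gmul_linear_right[OF U f] g])
    show "op_act E U (i + j) d (gmul C U i j f g) F = op_act E U i (j + d) f (op_act E U j d g F)"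
      by (rule H_eqI[OF U H_act[OF U fg F]])
        (simp_all add: H_act[OF U f H_act[OF U g F]] act_assoc[OF U f g secE[OF U F]] add.assoc add.left_commute)
  qed
  show "act (op_sheaf X E H) U 0 d (gone C U) F = F" if "F \<in> secs (op_sheaf X E H) U d" for d F
    unfolding op_sheaf_fields
  proof -
    have F: "F \<in> H U d" using that by simp
    have "op_act E U 0 d (gone C U) F \<in> H U d" using H_act[OF U alg.gone_closed[OF U] F] by simp
    then show "op_act E U 0 d (gone C U) F = F"
      by (rule H_eqI[OF U _ F]) (simp add: act_gone[OF U secE[OF U F]])
  qed
  show "rst (op_sheaf X E H) U V (i + d) (act (op_sheaf X E H) U i d f F) =
      act (op_sheaf X E H) V i d (rst C U V i f) (rst (op_sheaf X E H) U V d F)"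
    if "openin X V" "V \<subseteq> U" "f \<in> secs C U i" "F \<in> secs (op_sheaf X E H) U d" for V i d f F
    using that by (simp add: op_rst_act U H_LocD)
qed

end

lemma (in gmod_sheaf_with_cutoffs) Loc_subsheaf: "local_operator_subsheaf X C E (Loc X E)"
  by unfold_locales (auto intro: op_zero_Loc op_add_Loc op_smult_Loc op_act_Loc op_rst_Loc)

lemma (in local_operator_subsheaf) gmod_subsheaf_Loc:
  "gmod_subsheaf X C (Loc_sheaf X E) (op_sheaf X E H)"
proof (intro gmod_subsheaf.intro gmod_subsheaf_axioms.intro)
  show "gmod_sheaf X C (Loc_sheaf X E)"
    unfolding Loc_sheaf_def by (rule local_operator_subsheaf.op_gmod_sheaf[OF Loc_subsheaf])
  show "gmod_sheaf X C (op_sheaf X E H)" by (rule op_gmod_sheaf)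
qed (use H_Loc in \<open>auto simp: Loc_sheaf_def\<close>)

section \<open>Commutators with multiplication operators\<close>

text \<open>The composition \<open>F \<circ> \<lambda>\<^sub>f\<close> of an operator with the multiplication by a function of degree \<open>i\<close>:\<close>

definition op_mulr :: "('x, 'a, 's, 'm) gmod_sheaf_scheme \<Rightarrow> 'x set \<Rightarrow> int \<Rightarrow> 'a \<Rightarrow>
    (int \<Rightarrow> 's \<Rightarrow> 's) \<Rightarrow> int \<Rightarrow> 's \<Rightarrow> 's" where
  "op_mulr E U i f F = (\<lambda>j. \<lambda>\<psi>\<in>secs E U j. F (i + j) (act E U i j f \<psi>))"

lemma sign_add: "(-1 :: real) powi (a + b) = (-1) powi a * (-1) powi b"
  by (simp add: power_int_add)

context gmod_sheaf_with_cutoffs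
begin

abbreviation commutator :: "'x set \<Rightarrow> int \<Rightarrow> (int \<Rightarrow> 's \<Rightarrow> 's) \<Rightarrow> int \<Rightarrow> 'a \<Rightarrow> int \<Rightarrow> 's \<Rightarrow> 's" where
  "commutator U d D i f \<equiv> gcomm E U d D i (mul_op E U i f)"

lemma op_mulr_apply: "\<psi> \<in> secs E U j \<Longrightarrow> op_mulr E U i f F j \<psi> = F (i + j) (act E U i j f \<psi>)"
  by (simp add: op_mulr_def)

lemma op_mulr_graded:
  assumes U: "openin X U" and F: "F \<in> graded_maps E U d" and f: "f \<in> secs C U i"
  shows "op_mulr E U i f F \<in> graded_maps E U (d + i)"
proof (rule graded_mapsI)
  have deg: "i + j + d = j + (d + i)" for j by simp
  note Fsec = graded_maps_sec[OF F, of _ "i + j" for j, unfolded deg]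
  note Fadd = graded_maps_add[OF F, of _ "i + j" for j, unfolded deg]
  note Fsmult = graded_maps_smult[OF F, of _ "i + j" for j, unfolded deg]
  fix j s
  show "op_mulr E U i f F j s = undefined" if "s \<notin> secs E U j" using that by (simp add: op_mulr_def)
  assume s: "s \<in> secs E U j"
  note fs = act_sec[OF U f s]
  show "op_mulr E U i f F j s \<in> secs E U (j + (d + i))"
    using Fsec[OF fs] s by (simp add: op_mulr_apply)
  show "op_mulr E U i f F j (c \<odot>\<^bsub>Sec E U j\<^esub> s) = c \<odot>\<^bsub>Sec E U (j + (d + i))\<^esub> op_mulr E U i f F j s" for c
    using Fsmult[OF fs] act_smult_right[OF U f s] s by (simp add: op_mulr_apply smult_sec[OF U])
  show "op_mulr E U i f F j (s \<oplus>\<^bsub>Sec E U j\<^esub> t) =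
      op_mulr E U i f F j s \<oplus>\<^bsub>Sec E U (j + (d + i))\<^esub> op_mulr E U i f F j t" if t: "t \<in> secs E U j" for t
    using Fadd[OF fs act_sec[OF U f t]] act_add_right[OF U f s t] s t
    by (simp add: op_mulr_apply add_sec[OF U])
qed

lemma op_mulr_Loc:
  assumes U: "openin X U" and F: "F \<in> Loc X E U d" and f: "f \<in> secs C U i"
  shows "op_mulr E U i f F \<in> Loc X E U (d + i)"
proof (rule LocI[OF op_mulr_graded[OF U Loc_graded[OF F] f]])
  fix V j s assume V: "openin X V" "V \<subseteq> U" and s: "s \<in> secs E U j" "rst E U V j s = \<zero>\<^bsub>Sec E V j\<^esub>"
  have deg: "i + j + d = j + (d + i)" by simp
  have "rst E U V (i + j) (act E U i j f s) = \<zero>\<^bsub>Sec E V (i + j)\<^esub>"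
    using rst_act[OF U V f s(1)] s(2) act_zero_right[OF V(1) alg.rst_sec[OF U V f]] by simp
  from Loc_vanish[OF F V act_sec[OF U f s(1)] this]
  show "rst E U V (j + (d + i)) (op_mulr E U i f F j s) = \<zero>\<^bsub>Sec E V (j + (d + i))\<^esub>"
    using s by (simp add: op_mulr_apply deg)
qed

lemma op_rst_mulr:
  assumes U: "openin X U" and V: "openin X V" "V \<subseteq> U" and F: "F \<in> Loc X E U d" and f: "f \<in> secs C U i"
  shows "op_rst X E U V (d + i) (op_mulr E U i f F) = op_mulr E V i (rst C U V i f) (op_rst X E U V d F)"
proof (rule op_rst_unique[OF U V op_mulr_Loc[OF U F f] op_mulr_Loc[OF V(1) op_rst_Loc[OF U V F] alg.rst_sec[OF U V f]]])
  fix j \<psi> assume \<psi>: "\<psi> \<in> secs E U j"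
  have deg: "i + j + d = j + (d + i)" by simp
  show "rst E U V (j + (d + i)) (op_mulr E U i f F j \<psi>) =
      op_mulr E V i (rst C U V i f) (op_rst X E U V d F) j (rst E U V j \<psi>)"
    using op_rst_apply[OF U V F act_sec[OF U f \<psi>]] rst_act[OF U V f \<psi>] \<psi>
    by (simp add: op_mulr_apply rst_sec[OF U V] deg)
qed

lemma commutator_apply:
  assumes U: "openin X U" and D: "D \<in> graded_maps E U d" and f: "f \<in> secs C U i" and s: "s \<in> secs E U j"
  shows "commutator U d D i f j s = D (i + j) (act E U i j f s) \<oplus>\<^bsub>Sec E U (j + (d + i))\<^esub>
    (- ((-1) powi (d * i))) \<odot>\<^bsub>Sec E U (j + (d + i))\<^esub> act E U i (j + d) f (D j s)"
proof -
  have deg: "j + i = i + j" "j + d + i = j + (d + i)" "i + j + d = j + (d + i)" "i + (j + d) = j + (d + i)" by simp_all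
  have 1: "D (i + j) (act E U i j f s) \<in> secs E U (j + (d + i))"
    using graded_maps_sec[OF D act_sec[OF U f s]] by (simp only: deg)
  have 2: "act E U i (j + d) f (D j s) \<in> secs E U (j + (d + i))"
    using act_sec[OF U f graded_maps_sec[OF D s]] by (simp only: deg)
  show ?thesis
    using s graded_maps_sec[OF D s]
    by (simp add: gcomm_def mul_op_def deg(1,2) minus_eq_smult[OF U 1 smult_sec[OF U 2]] smult_smult[OF U 2])
qed

text \<open>
  \<open>[D, f] = D \<circ> \<lambda>\<^sub>f - (-1)\<^bsup>d i\<^esup> f D\<close>, so that locality of commutators and their compatibility with restriction
  follow from the same properties of the operations on the right-hand side.
\<close>

lemma commutator_eq:
  assumes U: "openin X U" and D: "D \<in> graded_maps E U d" and f: "f \<in> secs C U i"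
  shows "commutator U d D i f = op_add E U (d + i) (op_mulr E U i f D)
    (op_smult E U (d + i) (- ((-1) powi (d * i))) (op_act E U i d f D))"
proof (intro ext)
  fix j s
  show "commutator U d D i f j s = op_add E U (d + i) (op_mulr E U i f D)
    (op_smult E U (d + i) (- ((-1) powi (d * i))) (op_act E U i d f D)) j s"
  proof (cases "s \<in> secs E U j")
    case True
    then show ?thesis by (simp add: commutator_apply[OF U D f] op_mulr_apply)
  next
    case False
    then show ?thesis by (simp add: gcomm_def op_undefined)
  qed
qed

lemma op_act_degree:
  "openin X U \<Longrightarrow> F \<in> Loc X E U d \<Longrightarrow> f \<in> secs C U i \<Longrightarrow> op_act E U i d f F \<in> Loc X E U (d + i)"
  using op_act_Loc[of U F d f i] by (simp add: add.commute)

lemma commutator_graded: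
  assumes U: "openin X U" and D: "D \<in> graded_maps E U d" and f: "f \<in> secs C U i"
  shows "commutator U d D i f \<in> graded_maps E U (d + i)"
  unfolding commutator_eq[OF assms]
  using op_graded_maps(3)[OF U D D f]
  by (intro op_graded_maps[OF U] op_mulr_graded[OF U D f]) (simp_all add: add.commute)

lemma commutator_Loc:
  assumes U: "openin X U" and D: "D \<in> Loc X E U d" and f: "f \<in> secs C U i"
  shows "commutator U d D i f \<in> Loc X E U (d + i)"
  unfolding commutator_eq[OF U Loc_graded[OF D] f]
  by (intro op_add_Loc op_smult_Loc op_mulr_Loc op_act_degree assms)

lemma op_rst_commutator:
  assumes U: "openin X U" and V: "openin X V" "V \<subseteq> U" and D: "D \<in> Loc X E U d" and f: "f \<in> secs C U i"
  shows "op_rst X E U V (d + i) (commutator U d D i f) = commutator V d (op_rst X E U V d D) i (rst C U V i f)"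
proof -
  note act = op_act_degree[OF U D f]
  have "op_rst X E U V (d + i) (op_act E U i d f D) = op_act E V i d (rst C U V i f) (op_rst X E U V d D)"
    using op_rst_act[OF U V D f] by (simp add: add.commute)
  then show ?thesis
    by (simp add: commutator_eq[OF U Loc_graded[OF D] f]
        commutator_eq[OF V(1) Loc_graded[OF op_rst_Loc[OF U V D]] alg.rst_sec[OF U V f]]
        op_rst_add[OF U V op_mulr_Loc[OF U D f] op_smult_Loc[OF U act]] op_rst_smult[OF U V act]
        op_rst_mulr[OF U V D f])
qed

context
  fixes U f i
  assumes U: "openin X U" and f: "f \<in> secs C U i"
begin

lemma commutator_zero: "commutator U d (op_zero E U d) i f = op_zero E U (d + i)"
proof (rule graded_maps_eqI[OF commutator_graded[OF U op_zero_graded[OF U] f] op_zero_graded[OF U]])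
  fix j s assume s: "s \<in> secs E U j"
  have deg: "i + j + d = j + (d + i)" "i + (j + d) = j + (d + i)" by simp_all
  show "commutator U d (op_zero E U d) i f j s = op_zero E U (d + i) j s"
    using s act_sec[OF U f s]
    by (simp add: commutator_apply[OF U op_zero_graded[OF U] f] act_zero_right[OF U f] deg
        smult_zero_right[OF U] sec_zero_left[OF U] zero_sec[OF U])
qed

lemma commutator_add:
  assumes D: "D \<in> graded_maps E U d" and D': "D' \<in> graded_maps E U d"
  shows "commutator U d (op_add E U d D D') i f = op_add E U (d + i) (commutator U d D i f) (commutator U d D' i f)"
proof (rule graded_maps_eqI)
  note DD' = op_graded_maps(1)[OF U D D']
  show "commutator U d (op_add E U d D D') i f \<in> graded_maps E U (d + i)"
    by (rule commutator_graded[OF U DD' f])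
  show "op_add E U (d + i) (commutator U d D i f) (commutator U d D' i f) \<in> graded_maps E U (d + i)"
    by (intro op_graded_maps commutator_graded U D D' f)
  fix j s assume s: "s \<in> secs E U j"
  have deg: "i + j + d = j + (d + i)" "i + (j + d) = j + (d + i)" by simp_all
  note fs = act_sec[OF U f s]
  note sec = graded_maps_sec[OF D fs, unfolded deg] graded_maps_sec[OF D' fs, unfolded deg]
    act_sec[OF U f graded_maps_sec[OF D s], unfolded deg] act_sec[OF U f graded_maps_sec[OF D' s], unfolded deg]
  show "commutator U d (op_add E U d D D') i f j s =
      op_add E U (d + i) (commutator U d D i f) (commutator U d D' i f) j s"
    using s act_add_right[OF U f graded_maps_sec[OF D s] graded_maps_sec[OF D' s]] fs
    by (simp add: commutator_apply[OF U DD' f] commutator_apply[OF U D f] commutator_apply[OF U D' f] deg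
        sec sec_algebra[OF U] add_sec[OF U] smult_sec[OF U])
qed

lemma commutator_smult:
  assumes D: "D \<in> graded_maps E U d"
  shows "commutator U d (op_smult E U d c D) i f = op_smult E U (d + i) c (commutator U d D i f)"
proof (rule graded_maps_eqI)
  note cD = op_graded_maps(2)[OF U D D]
  show "commutator U d (op_smult E U d c D) i f \<in> graded_maps E U (d + i)"
    by (rule commutator_graded[OF U cD f])
  show "op_smult E U (d + i) c (commutator U d D i f) \<in> graded_maps E U (d + i)"
    by (rule op_graded_maps(2)[OF U commutator_graded[OF U D f] commutator_graded[OF U D f]])
  fix j s assume s: "s \<in> secs E U j"
  have deg: "i + j + d = j + (d + i)" "i + (j + d) = j + (d + i)" by simp_all
  note fs = act_sec[OF U f s]
  note sec = graded_maps_sec[OF D fs, unfolded deg] act_sec[OF U f graded_maps_sec[OF D s], unfolded deg]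
  show "commutator U d (op_smult E U d c D) i f j s = op_smult E U (d + i) c (commutator U d D i f) j s"
    using s act_smult_right[OF U f graded_maps_sec[OF D s]] fs
    by (simp add: commutator_apply[OF U cD f] commutator_apply[OF U D f] deg
        sec sec_algebra[OF U] add_sec[OF U] smult_sec[OF U] mult.commute)
qed

text \<open>
  \<open>[g D, f] = g [D, f]\<close>: the sign from moving \<open>f\<close> past \<open>g\<close> cancels the factor \<open>(-1)\<^bsup>|g| |f|\<^esup>\<close>
  in the sign of the commutator on the left.
\<close>

lemma commutator_act:
  assumes D: "D \<in> graded_maps E U d" and g: "g \<in> secs C U l"
  shows "commutator U (l + d) (op_act E U l d g D) i f = op_act E U l (d + i) g (commutator U d D i f)"
proof (rule graded_maps_eqI)
  note gD = op_graded_maps(3)[OF U D D g]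
  show "commutator U (l + d) (op_act E U l d g D) i f \<in> graded_maps E U (l + d + i)"
    by (rule commutator_graded[OF U gD f])
  show "op_act E U l (d + i) g (commutator U d D i f) \<in> graded_maps E U (l + d + i)"
    using op_graded_maps(3)[OF U commutator_graded[OF U D f] commutator_graded[OF U D f] g]
    by (simp add: add.assoc)
  fix j s assume s: "s \<in> secs E U j"
  define N where "N = j + (d + i)"
  define M where "M = l + N"
  have deg: "i + j + d = N" "i + (j + d) = N" "j + (d + i) = N" "l + N = M" "j + (l + d + i) = M"
    "i + (l + (j + d)) = M" "j + (l + d) = l + (j + d)" by (simp_all add: N_def M_def)
  note fs = act_sec[OF U f s] and Ds = graded_maps_sec[OF D s]
  have a: "D (i + j) (act E U i j f s) \<in> secs E U N"
    using graded_maps_sec[OF D fs] by (simp only: deg)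
  have b: "act E U i (j + d) f (D j s) \<in> secs E U N"
    using act_sec[OF U f Ds] by (simp only: deg)
  have swap: "act E U i (l + (j + d)) f (act E U l (j + d) g (D j s)) =
      ((-1) powi (i * l)) \<odot>\<^bsub>Sec E U M\<^esub> act E U l N g (act E U i (j + d) f (D j s))"
    using act_swap[OF U f g Ds] by (simp only: deg)
  have sign: "(-1 :: real) powi ((l + d) * i) * (-1) powi (i * l) = (-1) powi (d * i)"
    by (simp add: distrib_right sign_add mult.commute[of i l] mult.assoc mult.left_commute[of "(-1) powi (l * i)"])
  have ga: "act E U l N g (D (i + j) (act E U i j f s)) \<in> secs E U M"
    and gb: "act E U l N g (act E U i (j + d) f (D j s)) \<in> secs E U M"
    using act_sec[OF U g a] act_sec[OF U g b] by (simp_all only: deg)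
  have "commutator U (l + d) (op_act E U l d g D) i f j s = act E U l N g (D (i + j) (act E U i j f s)) \<oplus>\<^bsub>Sec E U M\<^esub>
      (- ((-1) powi (d * i))) \<odot>\<^bsub>Sec E U M\<^esub> act E U l N g (act E U i (j + d) f (D j s))"
    using s fs by (simp add: commutator_apply[OF U gD f s] deg swap smult_smult[OF U gb] sign)
  also have "\<dots> = act E U l N g (commutator U d D i f j s)"
    unfolding commutator_apply[OF U D f s] deg
    using act_add_right[OF U g a smult_sec[OF U b]] act_smult_right[OF U g b] by (simp add: deg)
  finally show "commutator U (l + d) (op_act E U l d g D) i f j s = op_act E U l (d + i) g (commutator U d D i f) j s"
    using s by (simp add: deg)
qed

end

text \<open>Only the commutators with cutoff functions, which have degree 0, are needed:\<close>

lemma local_if_commutators_local: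
  assumes U: "openin X U" and D: "D \<in> graded_maps E U d"
    and comm: "\<And>l. l \<in> secs C U 0 \<Longrightarrow> commutator U d D 0 l \<in> Loc X E U d"
  shows "D \<in> Loc X E U d"
proof (rule LocI[OF D])
  fix V j s assume V: "openin X V" "V \<subseteq> U" and s: "s \<in> secs E U j" "rst E U V j s = \<zero>\<^bsub>Sec E V j\<^esub>"
  note Ds = graded_maps_sec[OF D s(1)]
  show "rst E U V (j + d) (D j s) = \<zero>\<^bsub>Sec E V (j + d)\<^esub>"
  proof (rule sec_eqI_local[OF V(1) rst_sec[OF U V Ds] zero_sec[OF V(1)]])
    fix x assume "x \<in> V"
    then obtain l W Z where l: "l \<in> secs C U 0" and W: "openin X W" "x \<in> W" "W \<subseteq> V"
      and Z: "openin X Z" "Z \<subseteq> U" "U = V \<union> Z"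
      and l': "rst C U W 0 l = gone C W" "rst C U Z 0 l = \<zero>\<^bsub>Sec C Z 0\<^esub>"
      by (rule cutoff_on[OF U V])
    have WU: "W \<subseteq> U" using W V by blast
    have ls_sec: "act E U 0 j l s \<in> secs E U j" using act_sec[OF U l s(1)] by simp
    have ls: "act E U 0 j l s = \<zero>\<^bsub>Sec E U j\<^esub>"
    proof (rule sec_eqI_local[OF U ls_sec zero_sec[OF U]])
      have "rst E U V j (act E U 0 j l s) = \<zero>\<^bsub>Sec E V j\<^esub>"
        using rst_act[OF U V l s(1)] s(2) act_zero_right[OF V(1) alg.rst_sec[OF U V l], of j] by simp
      moreover have "rst E U Z j (act E U 0 j l s) = \<zero>\<^bsub>Sec E Z j\<^esub>"
        using rst_act[OF U Z(1,2) l s(1)] l'(2) act_zero_left[OF Z(1) rst_sec[OF U Z(1,2) s(1)], of 0] by simp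
      ultimately show "\<exists>N. openin X N \<and> y \<in> N \<and> N \<subseteq> U \<and>
          rst E U N j (act E U 0 j l s) = rst E U N j \<zero>\<^bsub>Sec E U j\<^esub>" if "y \<in> U" for y
        using that Z V rst_zero[OF U] by (metis UnE)
    qed
    have lDs: "act E U 0 (j + d) l (D j s) \<in> secs E U (j + d)" using act_sec[OF U l Ds] by simp
    have "rst E U W j s = \<zero>\<^bsub>Sec E W j\<^esub>"
      using rst_rst[OF U V(1) W(1,3) V(2) s(1)] s(2) rst_zero[OF V(1) W(1,3)] by simp
    then have "rst E U W (j + d) (commutator U d D 0 l j s) = \<zero>\<^bsub>Sec E W (j + d)\<^esub>"
      by (rule Loc_vanish[OF comm[OF l] W(1) WU s(1)])
    moreover have "commutator U d D 0 l j s = (- 1) \<odot>\<^bsub>Sec E U (j + d)\<^esub> act E U 0 (j + d) l (D j s)"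
      using commutator_apply[OF U D l s(1)] ls graded_maps_zero[OF U D] lDs
      by (simp add: sec_zero_left[OF U smult_sec[OF U]])
    ultimately have "(- 1) \<odot>\<^bsub>Sec E W (j + d)\<^esub> rst E U W (j + d) (D j s) = \<zero>\<^bsub>Sec E W (j + d)\<^esub>"
      using rst_act[OF U W(1) WU l Ds] rst_smult[OF U W(1) WU lDs] l'(1)
        act_gone[OF W(1) rst_sec[OF U W(1) WU Ds]] by simp
    then have "rst E U W (j + d) (D j s) = (- 1) \<odot>\<^bsub>Sec E W (j + d)\<^esub> \<zero>\<^bsub>Sec E W (j + d)\<^esub>"
      using smult_smult[OF W(1) rst_sec[OF U W(1) WU Ds], of "- 1" "- 1"] smult_one[OF W(1) rst_sec[OF U W(1) WU Ds]]
      by simp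
    then have "rst E V W (j + d) (rst E U V (j + d) (D j s)) = rst E V W (j + d) \<zero>\<^bsub>Sec E V (j + d)\<^esub>"
      using rst_rst[OF U V(1) W(1,3) V(2) Ds] rst_zero[OF V(1) W(1,3)] smult_zero_right[OF W(1)] by simp
    then show "\<exists>W. openin X W \<and> x \<in> W \<and> W \<subseteq> V \<and>
        rst E V W (j + d) (rst E U V (j + d) (D j s)) = rst E V W (j + d) \<zero>\<^bsub>Sec E V (j + d)\<^esub>"
      using W by blast
  qed
qed

lemma op_rst_zero:
  assumes U: "openin X U" and V: "openin X V" "V \<subseteq> U"
  shows "op_rst X E U V d (op_zero E U d) = op_zero E V d"
  by (rule op_rst_unique[OF U V op_zero_Loc[OF U] op_zero_Loc[OF V(1)]]) (simp add: rst_sec[OF U V] rst_zero[OF U V])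

section \<open>Differential operators\<close>

text \<open>The zero operators play the part of the differential operators of order \<open>-1\<close>.\<close>

lemma zero_subsheaf: "local_operator_subsheaf X C E (\<lambda>U d. {op_zero E U d})"
proof (unfold_locales, goal_cases)
  case (3 U F d G)
  note z = op_zero_graded[OF 3(1), of d]
  have "op_add E U d (op_zero E U d) (op_zero E U d) = op_zero E U d"
    by (rule graded_maps_eqI[OF op_graded_maps(1)[OF 3(1) z z] z]) (simp add: sec_zero_left zero_sec 3(1))
  then show ?case using 3 by simp
next
  case (4 U F d c)
  note z = op_zero_graded[OF 4(1), of d]
  have "op_smult E U d c (op_zero E U d) = op_zero E U d"
    by (rule graded_maps_eqI[OF op_graded_maps(2)[OF 4(1) z z] z]) (simp add: smult_zero_right 4(1))
  then show ?case using 4 by simp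
next
  case (5 U f i F d)
  note z = op_zero_graded[OF 5(1), of d]
  have "op_act E U i d f (op_zero E U d) = op_zero E U (i + d)"
    by (rule graded_maps_eqI[OF op_graded_maps(3)[OF 5(1) z z 5(2)] op_zero_graded[OF 5(1)]])
      (simp add: act_zero_right[OF 5(1,2)] add.left_commute)
  then show ?case using 5 by simp
next
  case (7 \<V> F d)
  then have U: "openin X (\<Union>\<V>)" by (simp add: openin_Union)
  have "op_rst X E (\<Union>\<V>) V d F = op_rst X E (\<Union>\<V>) V d (op_zero E (\<Union>\<V>) d)" if "V \<in> \<V>" for V
    using 7 that op_rst_zero[OF U _ Union_upper[OF that]] by simp
  then show ?case using Loc_separated[OF 7(1,2) op_zero_Loc[OF U]] by blast
qed (auto intro: op_zero_Loc op_rst_zero)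

lemma commutator_subsheaf:
  assumes K: "local_operator_subsheaf X C E K"
    and H: "\<And>U d. openin X U \<Longrightarrow>
      H U d = {D \<in> Loc X E U d. \<forall>i. \<forall>f\<in>secs C U i. commutator U d D i f \<in> K U (d + i)}"
  shows "local_operator_subsheaf X C E H"
proof -
  interpret K: local_operator_subsheaf X C E K by (rule K)
  show ?thesis
  proof (unfold_locales, goal_cases)
    case (1 U d)
    then show ?case by (auto simp: H)
  next
    case (2 U d)
    then show ?case by (auto simp: H commutator_zero K.H_zero intro: op_zero_Loc)
  next
    case (3 U F d G)
    then show ?case by (auto simp: H commutator_add Loc_graded K.H_add intro: op_add_Loc)
  next
    case (4 U F d c)
    then show ?case by (auto simp: H commutator_smult Loc_graded K.H_smult intro: op_smult_Loc)
  next
    case (5 U f i F d)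
    have "commutator U (i + d) (op_act E U i d f F) l g \<in> K U (i + d + l)" if g: "g \<in> secs C U l" for l g
      using 5 K.H_act[OF 5(1,2), of "commutator U d F l g" "d + l"] that
      by (simp add: H commutator_act Loc_graded add.assoc)
    then show ?case using 5 by (auto simp: H intro: op_act_Loc)
  next
    case (6 U V F d)
    then have U: "openin X U" and V: "openin X V" "V \<subseteq> U" and F: "F \<in> Loc X E U d"
      and comm: "\<And>i f. f \<in> secs C U i \<Longrightarrow> commutator U d F i f \<in> K U (d + i)" by (auto simp: H)
    let ?G = "op_rst X E U V d F"
    note G = op_rst_Loc[OF U V F]
    \<comment> \<open>\<open>f\<close> extends to \<open>U\<close> only near each point, so membership in \<open>K\<close> is checked on the cover \<open>\<V>\<close> of \<open>V\<close>.\<close>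
    have "commutator V d ?G i f \<in> K V (d + i)" if f: "f \<in> secs C V i" for i f
    proof -
      define \<V> where "\<V> = {W. openin X W \<and> W \<subseteq> V \<and> (\<exists>g\<in>secs C U i. rst C U W i g = rst C V W i f)}"
      have UN: "\<Union>\<V> = V"
      proof
        show "V \<subseteq> \<Union>\<V>"
        proof
          fix x assume "x \<in> V"
          then obtain g W where "g \<in> secs C U i" "openin X W" "x \<in> W" "W \<subseteq> V" "rst C U W i g = rst C V W i f"
            by (rule extend_function_locally[OF U V _ f])
          then show "x \<in> \<Union>\<V>" by (auto simp: \<V>_def)
        qed
      qed (auto simp: \<V>_def)
      have "op_rst X E V W (d + i) (commutator V d ?G i f) \<in> K W (d + i)" if "W \<in> \<V>" for W
      proof -
        obtain g where W: "openin X W" "W \<subseteq> V" and g: "g \<in> secs C U i" "rst C U W i g = rst C V W i f"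
          using \<open>W \<in> \<V>\<close> by (auto simp: \<V>_def)
        have WU: "W \<subseteq> U" using W V by blast
        have "op_rst X E V W (d + i) (commutator V d ?G i f) = op_rst X E U W (d + i) (commutator U d F i g)"
          using op_rst_commutator[OF V(1) W G f] op_rst_commutator[OF U W(1) WU F g(1)]
            op_rst_trans[OF U V W F] g(2) by simp
        then show ?thesis using K.H_rst[OF U W(1) WU comm[OF g(1)]] by simp
      qed
      moreover have "\<forall>W\<in>\<V>. openin X W" by (auto simp: \<V>_def)
      ultimately show ?thesis
        using K.H_local[of \<V> "commutator V d ?G i f" "d + i"] commutator_Loc[OF V(1) G f] UN by auto
    qed
    then show ?case using G V by (simp add: H)
  next
    case (7 \<V> F d)
    then have U: "openin X (\<Union>\<V>)" by (simp add: openin_Union)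
    have "commutator (\<Union>\<V>) d F i f \<in> K (\<Union>\<V>) (d + i)" if f: "f \<in> secs C (\<Union>\<V>) i" for i f
    proof (rule K.H_local[OF 7(1) commutator_Loc[OF U 7(2) f]], intro ballI)
      fix V assume VV: "V \<in> \<V>"
      then have V: "openin X V" "V \<subseteq> \<Union>\<V>" using 7 by auto
      show "op_rst X E (\<Union>\<V>) V (d + i) (commutator (\<Union>\<V>) d F i f) \<in> K V (d + i)"
        using 7(3) VV H[OF V(1)] op_rst_commutator[OF U V 7(2) f] alg.rst_sec[OF U V f] by auto
    qed
    then show ?case using 7(2) U by (simp add: H)
  qed
qed

lemma Dif_0_eq:
  assumes U: "openin X U"
  shows "Dif C E 0 U d =
    {D \<in> graded_maps E U d. \<forall>i. \<forall>f\<in>secs C U i. commutator U d D i f = op_zero E U (d + i)}"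
proof -
  have "(\<forall>i j. \<forall>f\<in>secs C U i. \<forall>\<psi>\<in>secs E U j. D (i + j) (act E U i j f \<psi>) =
      ((-1) powi (d * i)) \<odot>\<^bsub>Sec E U (i + j + d)\<^esub> act E U i (j + d) f (D j \<psi>)) \<longleftrightarrow>
    (\<forall>i. \<forall>f\<in>secs C U i. commutator U d D i f = op_zero E U (d + i))" (is "?L \<longleftrightarrow> ?R")
    if D: "D \<in> graded_maps E U d" for D
  proof -
    have *: "commutator U d D i f j s = op_zero E U (d + i) j s \<longleftrightarrow> D (i + j) (act E U i j f s) =
      ((-1) powi (d * i)) \<odot>\<^bsub>Sec E U (i + j + d)\<^esub> act E U i (j + d) f (D j s)"
      if f: "f \<in> secs C U i" and s: "s \<in> secs E U j" for i j f s
    proof -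
      have deg: "i + j + d = j + (d + i)" "i + (j + d) = j + (d + i)" by simp_all
      have a: "D (i + j) (act E U i j f s) \<in> secs E U (j + (d + i))"
        using graded_maps_sec[OF D act_sec[OF U f s]] by (simp only: deg)
      have b: "act E U i (j + d) f (D j s) \<in> secs E U (j + (d + i))"
        using act_sec[OF U f graded_maps_sec[OF D s]] by (simp only: deg)
      show ?thesis
        using diff_eq_zero_iff[OF U a smult_sec[OF U b, of "(-1) powi (d * i)"]] s
        by (simp add: commutator_apply[OF U D f s] deg smult_smult[OF U b])
    qed
    show ?thesis
    proof
      assume L: ?L
      show ?R
      proof (intro allI ballI)
        fix i f assume f: "f \<in> secs C U i"
        show "commutator U d D i f = op_zero E U (d + i)"
        proof (rule graded_maps_eqI[OF commutator_graded[OF U D f] op_zero_graded[OF U]])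
          show "commutator U d D i f j s = op_zero E U (d + i) j s" if s: "s \<in> secs E U j" for j s
            by (rule *[OF f s, THEN iffD2]) (rule L[rule_format, OF f s])
        qed
      qed
    next
      assume R: ?R
      show ?L
      proof (intro allI ballI)
        fix i j f s assume f: "f \<in> secs C U i" and s: "s \<in> secs E U j"
        show "D (i + j) (act E U i j f s) =
            ((-1) powi (d * i)) \<odot>\<^bsub>Sec E U (i + j + d)\<^esub> act E U i (j + d) f (D j s)"
          by (rule *[OF f s, THEN iffD1]) (simp only: R[rule_format, OF f])
      qed
    qed
  qed
  then show ?thesis unfolding Dif.simps by (intro Collect_cong conj_cong refl)
qed

lemma Dif_subsheaf: "local_operator_subsheaf X C E (Dif C E k)"
proof (induction k)
  case 0
  have "Dif C E 0 U d = {D \<in> Loc X E U d. \<forall>i. \<forall>f\<in>secs C U i. commutator U d D i f \<in> {op_zero E U (d + i)}}"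
    if U: "openin X U" for U d
  proof -
    have "D \<in> Loc X E U d" if "D \<in> graded_maps E U d"
      and "\<forall>i. \<forall>f\<in>secs C U i. commutator U d D i f = op_zero E U (d + i)" for D
    proof (rule local_if_commutators_local[OF U that(1)])
      fix l assume "l \<in> secs C U 0"
      with that(2) have "commutator U d D 0 l = op_zero E U (d + 0)" by blast
      then show "commutator U d D 0 l \<in> Loc X E U d" using op_zero_Loc[OF U, of d] by simp
    qed
    then show ?thesis unfolding Dif_0_eq[OF U] singleton_iff using Loc_graded by blast
  qed
  then show ?case by (rule commutator_subsheaf[OF zero_subsheaf])
next
  case (Suc k)
  interpret K: local_operator_subsheaf X C E "Dif C E k" by (rule Suc)
  have "Dif C E (Suc k) U d = {D \<in> Loc X E U d. \<forall>i. \<forall>f\<in>secs C U i. commutator U d D i f \<in> Dif C E k U (d + i)}"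
    if U: "openin X U" for U d
  proof -
    have "D \<in> Loc X E U d" if "D \<in> graded_maps E U d"
      and comm: "\<forall>i. \<forall>f\<in>secs C U i. commutator U d D i f \<in> Dif C E k U (d + i)" for D
    proof (rule local_if_commutators_local[OF U that(1)])
      fix l assume "l \<in> secs C U 0"
      with comm have "commutator U d D 0 l \<in> Dif C E k U (d + 0)" by blast
      then show "commutator U d D 0 l \<in> Loc X E U d" using K.H_LocD[OF U] by simp
    qed
    then show ?thesis unfolding Dif.simps using Loc_graded by blast
  qed
  then show ?case by (rule commutator_subsheaf[OF Suc])
qed

end

theorem proposition2p3:
  fixes X :: "'x topology" and n r :: "int \<Rightarrow> nat"
    and C :: "('x, 'a) galg_sheaf" and E :: "('x, 'a, 's) gmod_sheaf"
  assumes "graded_manifold X n C"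
    and "graded_vector_bundle X n C r E"
  shows "(\<forall>k U d. openin X U \<longrightarrow> Dif C E k U d \<subseteq> Loc X E U d) \<and>
    (\<forall>k. gmod_subsheaf X C (Loc_sheaf X E) (Dif_sheaf X C E k))"
proof -
  interpret graded_vector_bundle X n C r E by (rule assms(2))
  interpret gmod_sheaf_with_cutoffs X C E
    by unfold_locales (rule exists_cutoff)
  show ?thesis
  proof (intro conjI allI impI)
    fix k
    interpret Dif_k: local_operator_subsheaf X C E "Dif C E k" by (rule Dif_subsheaf)
    show "Dif C E k U d \<subseteq> Loc X E U d" if "openin X U" for U d
      by (rule Dif_k.H_Loc[OF that])
    show "gmod_subsheaf X C (Loc_sheaf X E) (Dif_sheaf X C E k)"
      unfolding Dif_sheaf_def by (rule Dif_k.gmod_subsheaf_Loc)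
  qed
qed

end
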